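(* Let $1<p\le2$, $p'=p/(p-1)$, and $p\le b\le p'$. Assume $\sup_{\xi}\|u_\xi\|_{L^\infty(\overline{M})}/\|v_\xi\|_{L^\infty(\overline{M})}<\infty$. Let $\varphi$ be a positive function on $\mathcal{I}$ with $M_\varphi:=\sup_{t>0}t\sum_{\xi:\,t\le\varphi(\xi)}\|v_\xi\|^2_{L^\infty(\overline{M})}<\infty$. Then for every $f\in L^p(\overline{M})$, $$\Big(\sum_{\xi\in\mathcal{I}}\big(|\mathcal{F}_{L^*}f(\xi)|\,\varphi(\xi)^{\frac1b-\frac1{p'}}\big)^b\,\|v_\xi\|_{L^\infty(\overline{M})}^{1-\frac{b}{p'}}\,\|u_\xi\|_{L^\infty(\overline{M})}^{1-\frac{b}{p}}\Big)^{1/b}\lesssim_p M_\varphi^{\frac1b-\frac1{p'}}\|f\|_{L^p(\overline{M})}.$$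
   Context: Standing setup: $\overline{M}$ is a smooth orientable manifold with (possibly empty) boundary and smooth density $dx$. $L$ is a pseudo-differential operator on its interior with boundary conditions giving discrete spectrum $\{\lambda_\xi\}_{\xi\in\mathcal{I}}$, eigenfunctions $u_\xi$ of $L$ and $v_\xi$ of $L^*$ ($L^*v_\xi=\overline{\lambda_\xi}v_\xi$), $\|u_\xi\|_{L^2}=\|v_\xi\|_{L^2}=1$, $(u_\xi,v_\eta)_{L^2}=\delta_{\xi\eta}$, $\{u_\xi\}$ a Riesz basis of $L^2(\overline{M})$, $u_\xi,v_\xi\in L^\infty$. $\mathcal{F}_{L^*}f(\xi):=\int_{\overline{M}}f(x)\overline{u_\xi(x)}\,dx$. *)

theory Defs
  imports "HOL-Probability.Probability"
begin

text \<open>Complex-valued L^p membership and norms on a measure space M (the manifold with its density).\<close>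

definition in_Lp :: "'a measure \<Rightarrow> real \<Rightarrow> ('a \<Rightarrow> complex) \<Rightarrow> bool" where
  "in_Lp M p f \<longleftrightarrow> f \<in> borel_measurable M \<and> integrable M (\<lambda>x. norm (f x) powr p)"

definition Lp_norm :: "'a measure \<Rightarrow> real \<Rightarrow> ('a \<Rightarrow> complex) \<Rightarrow> real" where
  "Lp_norm M p f = (\<integral>x. norm (f x) powr p \<partial>M) powr (1 / p)"

definition in_Linf :: "'a measure \<Rightarrow> ('a \<Rightarrow> complex) \<Rightarrow> bool" where
  "in_Linf M f \<longleftrightarrow> f \<in> borel_measurable M \<and> esssup M (\<lambda>x. ereal (norm (f x))) < \<infinity>"

definition Linf_norm :: "'a measure \<Rightarrow> ('a \<Rightarrow> complex) \<Rightarrow> real" where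
  "Linf_norm M f = real_of_ereal (esssup M (\<lambda>x. ereal (norm (f x))))"

definition L2_inner :: "'a measure \<Rightarrow> ('a \<Rightarrow> complex) \<Rightarrow> ('a \<Rightarrow> complex) \<Rightarrow> complex" where
  "L2_inner M f g = (\<integral>x. f x * cnj (g x) \<partial>M)"

definition riesz_basis :: "'a measure \<Rightarrow> ('i \<Rightarrow> 'a \<Rightarrow> complex) \<Rightarrow> bool" where
  "riesz_basis M u \<longleftrightarrow>
     (\<forall>\<xi>. in_Lp M 2 (u \<xi>)) \<and>
     (\<exists>A B. 0 < A \<and> 0 < B \<and>
        (\<forall>F c. finite F \<longrightarrow>
           A * (\<Sum>\<xi>\<in>F. (norm (c \<xi>))\<^sup>2) \<le> (Lp_norm M 2 (\<lambda>x. \<Sum>\<xi>\<in>F. c \<xi> * u \<xi> x))\<^sup>2 \<and>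
           (Lp_norm M 2 (\<lambda>x. \<Sum>\<xi>\<in>F. c \<xi> * u \<xi> x))\<^sup>2 \<le> B * (\<Sum>\<xi>\<in>F. (norm (c \<xi>))\<^sup>2))) \<and>
     (\<forall>f. in_Lp M 2 f \<longrightarrow> (\<forall>\<epsilon>>0. \<exists>F c. finite F \<and>
           Lp_norm M 2 (\<lambda>x. f x - (\<Sum>\<xi>\<in>F. c \<xi> * u \<xi> x)) < \<epsilon>))"

definition FL_star :: "'a measure \<Rightarrow> ('i \<Rightarrow> 'a \<Rightarrow> complex) \<Rightarrow> ('a \<Rightarrow> complex) \<Rightarrow> 'i \<Rightarrow> complex" where
  "FL_star M u f \<xi> = (\<integral>x. f x * cnj (u \<xi> x) \<partial>M)"

definition M_phi :: "'a measure \<Rightarrow> ('i \<Rightarrow> 'a \<Rightarrow> complex) \<Rightarrow> ('i \<Rightarrow> real) \<Rightarrow> ennreal" where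
  "M_phi M v \<phi> = (SUP t\<in>{0<..}. ennreal t *
      (\<integral>\<^sup>+ \<xi>. ennreal ((Linf_norm M (v \<xi>))\<^sup>2) \<partial>count_space {\<xi>. t \<le> \<phi> \<xi>}))"

end

theory Submission
  imports Defs
begin

text \<open>The coefficient map is bounded from \<open>L\<^sup>2\<close> to \<open>\<ell>\<^sup>2\<close> (Bessel, dual to the upper Riesz bound) and
  satisfies \<open>\<bar>F f \<xi>\<bar> \<le> \<parallel>u \<xi>\<parallel>\<^sub>\<infinity> \<parallel>f\<parallel>\<^sub>1\<close>. Real interpolation by truncating \<open>f\<close> at a level depending on the height
  \<open>s\<close> of the level set gives the two endpoints: for \<open>b = p\<close> (Paley), Marcinkiewicz interpolation for
  \<open>F f / (\<phi> \<parallel>v\<parallel>\<^sub>\<infinity>)\<close> with respect to the weights \<open>\<phi>\<^sup>2 \<parallel>v\<parallel>\<^sub>\<infinity>\<^sup>2\<close>, where the bound on \<open>M_phi\<close> is what makes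
  the weak (1,1) estimate true; for \<open>b = p'\<close> (Hausdorff--Young), the same for \<open>F f / \<parallel>u\<parallel>\<^sub>\<infinity>\<close> with weights
  \<open>\<parallel>u\<parallel>\<^sub>\<infinity>\<^sup>2\<close>. Writing \<open>b = (1 - \<theta>) p + \<theta> p'\<close>, the summand is the geometric mean of the two endpoint
  summands, and Young's inequality finishes the proof.\<close>

section \<open>Power integrals and the layer cake formula\<close>

lemma nn_integral_powr_atLeastAtMost:
  fixes r a :: real
  assumes "r > 0" "a \<ge> 0"
  shows "(\<integral>\<^sup>+s. ennreal (s powr (r - 1)) * indicator {0..a} s \<partial>lborel) = ennreal (a powr r / r)"
proof -
  have "((\<lambda>s. s powr (r - 1)) has_integral (a powr r / r)) {0..a}"
    using has_integral_powr_from_0[of "r - 1" a] assms by simp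
  then show ?thesis
    by (intro nn_integral_has_integral_lebesgue') auto
qed

lemma nn_integral_powr_greaterThanLessThan:
  fixes r a :: real
  assumes "r > 0" "a \<ge> 0"
  shows "(\<integral>\<^sup>+s. ennreal (s powr (r - 1)) * indicator {0<..<a} s \<partial>lborel) = ennreal (a powr r / r)"
proof -
  have "AE s in lborel. s \<noteq> 0 \<and> s \<noteq> a"
    by (intro AE_conjI AE_lborel_singleton)
  then have "(\<integral>\<^sup>+s. ennreal (s powr (r - 1)) * indicator {0<..<a} s \<partial>lborel) =
    (\<integral>\<^sup>+s. ennreal (s powr (r - 1)) * indicator {0..a} s \<partial>lborel)"
    by (rule nn_integral_cong_AE[OF eventually_mono]) (auto simp: indicator_def)
  with nn_integral_powr_atLeastAtMost[OF assms] show ?thesis by simp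
qed

lemma nn_integral_powr_atLeast:
  fixes r a :: real
  assumes "r > 0" "a > 0"
  shows "(\<integral>\<^sup>+s. ennreal (s powr (- r - 1)) * indicator {a..} s \<partial>lborel) = ennreal (a powr (- r) / r)"
proof -
  have "((\<lambda>s. s powr (- r - 1)) has_integral (a powr (- r) / r)) {a..}"
    using has_integral_powr_to_inf[of "- r - 1" a] assms by simp
  then show ?thesis
    by (intro nn_integral_has_integral_lebesgue') auto
qed

text \<open>Each \<open>a \<xi> powr q\<close> is the integral of \<open>q * s powr (q - 1)\<close>
  over \<open>0 < s < a \<xi>\<close>, and the finite sum moves inside the integral. Working in
  \<open>ennreal\<close> lets distribution estimates be inserted under the integral without
  integrability side conditions.\<close>

lemma layer_cake_sum:
  fixes a \<nu> :: "'i \<Rightarrow> real"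
  assumes F: "finite F" and q: "q > 0"
    and a: "\<And>\<xi>. \<xi> \<in> F \<Longrightarrow> a \<xi> \<ge> 0" and \<nu>: "\<And>\<xi>. \<xi> \<in> F \<Longrightarrow> \<nu> \<xi> \<ge> 0"
  shows "ennreal (\<Sum>\<xi>\<in>F. \<nu> \<xi> * a \<xi> powr q) =
    (\<integral>\<^sup>+s. ennreal (q * s powr (q - 1)) * ennreal (\<Sum>\<xi>\<in>F. \<nu> \<xi> * of_bool (s < a \<xi>)) * indicator {0<..} s \<partial>lborel)"
proof -
  have "ennreal (\<Sum>\<xi>\<in>F. \<nu> \<xi> * a \<xi> powr q) = (\<Sum>\<xi>\<in>F. ennreal (\<nu> \<xi> * q) * ennreal (a \<xi> powr q / q))"
    using a \<nu> q by (subst sum_ennreal[symmetric]) (auto intro!: sum.cong simp: ennreal_mult[symmetric])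
  also have "\<dots> = (\<Sum>\<xi>\<in>F. \<integral>\<^sup>+s. ennreal (\<nu> \<xi> * q) * (ennreal (s powr (q - 1)) * indicator {0<..<a \<xi>} s) \<partial>lborel)"
    using a q by (intro sum.cong refl, subst nn_integral_cmult) (auto simp: nn_integral_powr_greaterThanLessThan)
  also have "\<dots> = (\<integral>\<^sup>+s. (\<Sum>\<xi>\<in>F. ennreal (\<nu> \<xi> * q) * (ennreal (s powr (q - 1)) * indicator {0<..<a \<xi>} s)) \<partial>lborel)"
    by (subst nn_integral_sum) auto
  also have "\<dots> = (\<integral>\<^sup>+s. ennreal (q * s powr (q - 1)) * ennreal (\<Sum>\<xi>\<in>F. \<nu> \<xi> * of_bool (s < a \<xi>)) * indicator {0<..} s \<partial>lborel)"
  proof (intro nn_integral_cong)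
    fix s :: real
    show "(\<Sum>\<xi>\<in>F. ennreal (\<nu> \<xi> * q) * (ennreal (s powr (q - 1)) * indicator {0<..<a \<xi>} s)) =
       ennreal (q * s powr (q - 1)) * ennreal (\<Sum>\<xi>\<in>F. \<nu> \<xi> * of_bool (s < a \<xi>)) * indicator {0<..} s"
      using \<nu> q
      by (subst sum_ennreal[symmetric])
         (auto simp: sum_distrib_left sum_distrib_right ennreal_mult indicator_def mult_ac intro!: sum.cong)
  qed
  finally show ?thesis .
qed

text \<open>The layer cake gives \<open>\<phi>\<^sup>2 = \<integral> 2 t [t < \<phi>] dt\<close>, and the weak hypothesis bounds the integrand by 2.\<close>

lemma sum_small_weights_le:
  fixes \<phi> w :: "'i \<Rightarrow> real"
  assumes F: "finite F" and pos: "\<And>\<xi>. \<phi> \<xi> > 0" and R: "R \<ge> 0"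
    and weak: "\<And>t. t > 0 \<Longrightarrow> t * (\<Sum>\<xi>\<in>{\<xi>\<in>F. t \<le> \<phi> \<xi>}. (w \<xi>)\<^sup>2) \<le> 1"
  shows "(\<Sum>\<xi>\<in>{\<xi>\<in>F. \<phi> \<xi> < R}. (\<phi> \<xi> * w \<xi>)\<^sup>2) \<le> 2 * R"
proof -
  let ?F = "{\<xi>\<in>F. \<phi> \<xi> < R}"
  have fin: "finite ?F" using F by auto
  have "ennreal (\<Sum>\<xi>\<in>?F. (w \<xi>)\<^sup>2 * \<phi> \<xi> powr 2) =
    (\<integral>\<^sup>+s. ennreal (2 * s powr (2 - 1)) * ennreal (\<Sum>\<xi>\<in>?F. (w \<xi>)\<^sup>2 * of_bool (s < \<phi> \<xi>)) * indicator {0<..} s \<partial>lborel)"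
    using fin pos by (intro layer_cake_sum) (auto intro: less_imp_le)
  also have "\<dots> \<le> (\<integral>\<^sup>+s. 2 * indicator {0..R} s \<partial>lborel)"
  proof (intro nn_integral_mono)
    fix s :: real
    show "ennreal (2 * s powr (2 - 1)) * ennreal (\<Sum>\<xi>\<in>?F. (w \<xi>)\<^sup>2 * of_bool (s < \<phi> \<xi>)) * indicator {0<..} s
      \<le> 2 * indicator {0..R} s"
    proof (cases "0 < s \<and> s \<le> R")
      case True
      have "(\<Sum>\<xi>\<in>?F. (w \<xi>)\<^sup>2 * of_bool (s < \<phi> \<xi>)) = (\<Sum>\<xi>\<in>{\<xi>\<in>?F. s < \<phi> \<xi>}. (w \<xi>)\<^sup>2)"
        by (rule sum.mono_neutral_cong_right) (use fin in auto)
      also have "\<dots> \<le> (\<Sum>\<xi>\<in>{\<xi>\<in>F. s \<le> \<phi> \<xi>}. (w \<xi>)\<^sup>2)"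
        using F by (intro sum_mono2) auto
      finally have "s * (\<Sum>\<xi>\<in>?F. (w \<xi>)\<^sup>2 * of_bool (s < \<phi> \<xi>)) \<le> 1"
        using weak[of s] True by (meson mult_left_mono order_trans less_imp_le)
      then have "2 * s * (\<Sum>\<xi>\<in>?F. (w \<xi>)\<^sup>2 * of_bool (s < \<phi> \<xi>)) \<le> 2" by simp
      then have "ennreal (2 * s * (\<Sum>\<xi>\<in>?F. (w \<xi>)\<^sup>2 * of_bool (s < \<phi> \<xi>))) \<le> ennreal 2"
        by (rule ennreal_leI)
      then show ?thesis using True
        by (simp add: ennreal_mult sum_nonneg)
    next
      \<comment> \<open>For \<open>s > R\<close> the level set is empty, because every index in
        \<open>?F\<close> has \<open>\<phi> \<xi> < R < s\<close>.\<close>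
      case False
      then have "s \<le> 0 \<or> (\<Sum>\<xi>\<in>?F. (w \<xi>)\<^sup>2 * of_bool (s < \<phi> \<xi>)) = 0"
        by (auto intro!: sum.neutral)
      then show ?thesis by auto
    qed
  qed
  also have "\<dots> = ennreal (2 * R)"
    using R by (simp add: nn_integral_cmult_indicator ennreal_mult)
  finally show ?thesis
    using R pos by (simp add: power_mult_distrib mult.commute less_imp_le)
qed

section \<open>Interpolation from estimates on level sets\<close>

lemma ennreal_mult_left_assoc:
  "a \<ge> 0 \<Longrightarrow> b \<ge> 0 \<Longrightarrow> ennreal a * (ennreal b * x) = ennreal (a * b) * x"
  by (simp add: ennreal_mult mult.assoc)

text \<open>Marcinkiewicz interpolation with the function cut at height \<open>s\<close> itself:
  \<open>D\<close> combines a weak (1,1) bound for the high part with a weak (2,2) bound for the low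
  part. After the layer cake and Tonelli, the integral of \<open>s powr (p - 2)\<close> up to
  \<open>G x\<close> converges because \<open>p > 1\<close>, and that of
  \<open>s powr (p - 3)\<close> from \<open>G x\<close> on because \<open>p < 2\<close>; both give
  multiples of \<open>G x powr p\<close>.\<close>

lemma paley_interpolation:
  fixes a \<nu> :: "'i \<Rightarrow> real" and G :: "'a \<Rightarrow> real"
  assumes M: "sigma_finite_measure M" and G [measurable]: "G \<in> borel_measurable M"
    and Gnn: "\<And>x. G x \<ge> 0" and p: "1 < p" "p < 2" and c: "c1 \<ge> 0" "c2 \<ge> 0"
    and F: "finite F" and a: "\<And>\<xi>. \<xi> \<in> F \<Longrightarrow> a \<xi> \<ge> 0" and \<nu>: "\<And>\<xi>. \<xi> \<in> F \<Longrightarrow> \<nu> \<xi> \<ge> 0"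
    and D: "\<And>s. s > 0 \<Longrightarrow> ennreal (\<Sum>\<xi>\<in>F. \<nu> \<xi> * of_bool (s < a \<xi>)) \<le>
        ennreal (c1 / s) * (\<integral>\<^sup>+x. ennreal (if s < G x then G x else 0) \<partial>M) +
        ennreal (c2 / s\<^sup>2) * (\<integral>\<^sup>+x. ennreal (if G x \<le> s then (G x)\<^sup>2 else 0) \<partial>M)"
  shows "ennreal (\<Sum>\<xi>\<in>F. \<nu> \<xi> * a \<xi> powr p) \<le>
    ennreal (p * c1 / (p - 1) + p * c2 / (2 - p)) * (\<integral>\<^sup>+x. ennreal (G x powr p) \<partial>M)"
proof -
  interpret M: sigma_finite_measure M by fact
  interpret P: pair_sigma_finite M lborel ..
  \<comment> \<open>The kernels are the layer cake density times the two integrands of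
    \<open>D\<close>. The exponents are left as \<open>r - 1\<close> with \<open>r = p - 1\<close>
    and \<open>- r - 1\<close> with \<open>r = 2 - p\<close>, the shapes of the power integrals
    above.\<close>
  define k1 where "k1 s x = (if 0 < s \<and> s < G x then ennreal (p * c1 * G x * s powr (p - 1 - 1)) else 0)" for s x
  define k2 where "k2 s x = (if 0 < s \<and> G x \<le> s then ennreal (p * c2 * (G x)\<^sup>2 * s powr (- (2 - p) - 1)) else 0)" for s x
  have [measurable]: "case_prod (\<lambda>x s. k1 s x) \<in> borel_measurable (M \<Otimes>\<^sub>M lborel)"
    "case_prod (\<lambda>x s. k2 s x) \<in> borel_measurable (M \<Otimes>\<^sub>M lborel)"
    "\<And>s. k1 s \<in> borel_measurable M" "\<And>s. k2 s \<in> borel_measurable M"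
    unfolding k1_def k2_def by measurable
  have "ennreal (\<Sum>\<xi>\<in>F. \<nu> \<xi> * a \<xi> powr p) =
    (\<integral>\<^sup>+s. ennreal (p * s powr (p - 1)) * ennreal (\<Sum>\<xi>\<in>F. \<nu> \<xi> * of_bool (s < a \<xi>)) * indicator {0<..} s \<partial>lborel)"
    using F p a \<nu> by (intro layer_cake_sum) auto
  also have "\<dots> \<le> (\<integral>\<^sup>+s. \<integral>\<^sup>+x. k1 s x + k2 s x \<partial>M \<partial>lborel)"
  proof (intro nn_integral_mono)
    fix s :: real
    show "ennreal (p * s powr (p - 1)) * ennreal (\<Sum>\<xi>\<in>F. \<nu> \<xi> * of_bool (s < a \<xi>)) * indicator {0<..} s
       \<le> (\<integral>\<^sup>+x. k1 s x + k2 s x \<partial>M)"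
    proof (cases "s > 0")
      case True
      have e1: "p * s powr (p - 1) * (c1 / s) = p * c1 * s powr (p - 1 - 1)"
        using True by (simp add: powr_diff power2_eq_square power3_eq_cube mult_ac)
      have e2: "p * s powr (p - 1) * (c2 / s\<^sup>2) = p * c2 * s powr (- (2 - p) - 1)"
        using True by (simp add: powr_diff power2_eq_square power3_eq_cube mult_ac)
      have "ennreal (p * s powr (p - 1)) * ennreal (\<Sum>\<xi>\<in>F. \<nu> \<xi> * of_bool (s < a \<xi>)) \<le>
        ennreal (p * s powr (p - 1)) * (ennreal (c1 / s) * (\<integral>\<^sup>+x. ennreal (if s < G x then G x else 0) \<partial>M) +
        ennreal (c2 / s\<^sup>2) * (\<integral>\<^sup>+x. ennreal (if G x \<le> s then (G x)\<^sup>2 else 0) \<partial>M))"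
        by (rule mult_left_mono[OF D[OF True]]) simp
      also have "\<dots> = (\<integral>\<^sup>+x. ennreal (p * c1 * s powr (p - 1 - 1)) * ennreal (if s < G x then G x else 0) \<partial>M) +
         (\<integral>\<^sup>+x. ennreal (p * c2 * s powr (- (2 - p) - 1)) * ennreal (if G x \<le> s then (G x)\<^sup>2 else 0) \<partial>M)"
        using True p c
        by (simp only: distrib_left e1[symmetric] e2[symmetric])
           (simp add: nn_integral_cmult ennreal_mult_left_assoc)
      also have "\<dots> = (\<integral>\<^sup>+x. k1 s x + k2 s x \<partial>M)"
        using True p c Gnn
        by (subst nn_integral_add[symmetric])
           (auto intro!: nn_integral_cong simp: k1_def k2_def mult_ac simp flip: ennreal_mult)
      finally show ?thesis using True by simp
    qed simp
  qed
  also have "\<dots> = (\<integral>\<^sup>+x. \<integral>\<^sup>+s. k1 s x + k2 s x \<partial>lborel \<partial>M)"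
    by (subst P.Fubini'[symmetric]) auto
  also have "\<dots> = (\<integral>\<^sup>+x. ennreal (p * c1 / (p - 1) + p * c2 / (2 - p)) * ennreal (G x powr p) \<partial>M)"
  proof (intro nn_integral_cong)
    fix x
    assume x: "x \<in> space M"
    have [measurable]: "(\<lambda>s. k1 s x) \<in> borel_measurable lborel" "(\<lambda>s. k2 s x) \<in> borel_measurable lborel"
      unfolding k1_def k2_def by measurable
    show "(\<integral>\<^sup>+s. k1 s x + k2 s x \<partial>lborel) =
       ennreal (p * c1 / (p - 1) + p * c2 / (2 - p)) * ennreal (G x powr p)"
    \<comment> \<open>The power integral over \<open>{G x..}\<close> needs a positive left end; at
      \<open>G x = 0\<close> both kernels vanish through their factors \<open>G x\<close> and
      \<open>(G x)\<^sup>2\<close>.\<close>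
    proof (cases "G x = 0")
      case True
      then have "k1 s x = 0" "k2 s x = 0" for s by (auto simp: k1_def k2_def)
      then show ?thesis using True by simp
    next
      case False
      then have G0: "G x > 0" using Gnn[of x] by simp
      have "(\<integral>\<^sup>+s. k1 s x \<partial>lborel) =
        (\<integral>\<^sup>+s. ennreal (p * c1 * G x) * (ennreal (s powr (p - 1 - 1)) * indicator {0<..<G x} s) \<partial>lborel)"
        using p c G0 by (intro nn_integral_cong) (auto simp: k1_def ennreal_mult indicator_def)
      also have "\<dots> = ennreal (p * c1 * G x) * ennreal (G x powr (p - 1) / (p - 1))"
        using p G0 by (subst nn_integral_cmult) (auto simp only: nn_integral_powr_greaterThanLessThan, measurable)
      also have "\<dots> = ennreal (p * c1 / (p - 1) * G x powr p)"
        using p c G0 by (subst ennreal_mult[symmetric]) (auto simp: powr_diff)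
      finally have i1: "(\<integral>\<^sup>+s. k1 s x \<partial>lborel) = ennreal (p * c1 / (p - 1) * G x powr p)" .
      have "(\<integral>\<^sup>+s. k2 s x \<partial>lborel) =
        (\<integral>\<^sup>+s. ennreal (p * c2 * (G x)\<^sup>2) * (ennreal (s powr (- (2 - p) - 1)) * indicator {G x..} s) \<partial>lborel)"
        using p c G0 by (intro nn_integral_cong) (auto simp: k2_def ennreal_mult indicator_def)
      also have "\<dots> = ennreal (p * c2 * (G x)\<^sup>2) * ennreal (G x powr (- (2 - p)) / (2 - p))"
        using p G0 by (subst nn_integral_cmult) (auto simp only: nn_integral_powr_atLeast, measurable)
      also have "\<dots> = ennreal (p * c2 / (2 - p) * G x powr p)"
        using p c G0 by (subst ennreal_mult[symmetric]) (auto simp: powr_diff powr_minus)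
      finally have i2: "(\<integral>\<^sup>+s. k2 s x \<partial>lborel) = ennreal (p * c2 / (2 - p) * G x powr p)" .
      show ?thesis
        using p c G0 by (subst nn_integral_add) (auto simp: i1 i2 distrib_right ennreal_mult[symmetric] ennreal_plus[symmetric] simp del: ennreal_plus)
    qed
  qed
  also have "\<dots> = ennreal (p * c1 / (p - 1) + p * c2 / (2 - p)) * (\<integral>\<^sup>+x. ennreal (G x powr p) \<partial>M)"
    by (rule nn_integral_cmult) auto
  finally show ?thesis .
qed


lemma powr_neg_le_iff:
  fixes x y e :: real
  assumes "e < 0" "x > 0" "y > 0"
  shows "y powr e \<le> x powr e \<longleftrightarrow> x \<le> y"
  using powr_mono2'[of e x y] powr_less_mono2_neg[of e y x] assms by (meson less_imp_le not_le)

text \<open>Here the cut height decreases in \<open>s\<close> and is chosen so that the high part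
  never reaches the level set, which is why \<open>D\<close> has only the L^2 term. By Tonelli, for
  fixed \<open>x\<close> the variable \<open>s\<close> runs up to
  \<open>2 * N * G x powr (1 - p)\<close>, and integrating \<open>s powr (q - 3)\<close> that far
  turns \<open>(G x)\<^sup>2\<close> into a multiple of \<open>G x powr p\<close>.\<close>

lemma hausdorff_young_interpolation:
  fixes a \<nu> :: "'i \<Rightarrow> real" and G :: "'a \<Rightarrow> real"
  assumes M: "sigma_finite_measure M" and G [measurable]: "G \<in> borel_measurable M"
    and Gnn: "\<And>x. G x \<ge> 0" and p: "1 < p" "p < 2" and q: "q = p / (p - 1)" and c: "c \<ge> 0"
    and N: "N > 0" "(\<integral>\<^sup>+x. ennreal (G x powr p) \<partial>M) = ennreal N"
    and F: "finite F" and a: "\<And>\<xi>. \<xi> \<in> F \<Longrightarrow> a \<xi> \<ge> 0" and \<nu>: "\<And>\<xi>. \<xi> \<in> F \<Longrightarrow> \<nu> \<xi> \<ge> 0"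
    and D: "\<And>s. s > 0 \<Longrightarrow> ennreal (\<Sum>\<xi>\<in>F. \<nu> \<xi> * of_bool (s < a \<xi>)) \<le>
        ennreal (c / s\<^sup>2) * (\<integral>\<^sup>+x. ennreal (if G x \<le> (s / (2 * N)) powr (- (1 / (p - 1))) then (G x)\<^sup>2 else 0) \<partial>M)"
  shows "(\<Sum>\<xi>\<in>F. \<nu> \<xi> * a \<xi> powr q) \<le> q * c / (q - 2) * 2 powr (q - 2) * N powr (q - 1)"
proof -
  interpret M: sigma_finite_measure M by fact
  interpret P: pair_sigma_finite M lborel ..
  have q2: "q > 2" using p by (simp add: q field_simps)
  \<comment> \<open>The choice of \<open>q\<close> as conjugate exponent enters here:
    \<open>(G x powr (1 - p)) powr (q - 2)\<close> times \<open>(G x)\<^sup>2\<close> is exactly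
    \<open>G x powr p\<close>.\<close>
  have qp: "(1 - p) * (q - 2) = p - 2" using p by (simp add: q field_simps)
  define k where "k s x = (if 0 < s \<and> G x \<le> (s / (2 * N)) powr (- (1 / (p - 1)))
     then ennreal (q * c * (G x)\<^sup>2 * s powr (q - 2 - 1)) else 0)" for s x
  have [measurable]: "case_prod (\<lambda>x s. k s x) \<in> borel_measurable (M \<Otimes>\<^sub>M lborel)"
    "\<And>s. k s \<in> borel_measurable M"
    unfolding k_def by measurable
  have "ennreal (\<Sum>\<xi>\<in>F. \<nu> \<xi> * a \<xi> powr q) =
    (\<integral>\<^sup>+s. ennreal (q * s powr (q - 1)) * ennreal (\<Sum>\<xi>\<in>F. \<nu> \<xi> * of_bool (s < a \<xi>)) * indicator {0<..} s \<partial>lborel)"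
    using F q2 a \<nu> by (intro layer_cake_sum) auto
  also have "\<dots> \<le> (\<integral>\<^sup>+s. \<integral>\<^sup>+x. k s x \<partial>M \<partial>lborel)"
  proof (intro nn_integral_mono)
    fix s :: real
    show "ennreal (q * s powr (q - 1)) * ennreal (\<Sum>\<xi>\<in>F. \<nu> \<xi> * of_bool (s < a \<xi>)) * indicator {0<..} s
       \<le> (\<integral>\<^sup>+x. k s x \<partial>M)"
    proof (cases "s > 0")
      case True
      let ?h = "(s / (2 * N)) powr (- (1 / (p - 1)))"
      have e: "q * s powr (q - 1) * (c / s\<^sup>2) = q * c * s powr (q - 2 - 1)"
        using True by (simp add: powr_diff power2_eq_square power3_eq_cube mult_ac)
      have "ennreal (q * s powr (q - 1)) * ennreal (\<Sum>\<xi>\<in>F. \<nu> \<xi> * of_bool (s < a \<xi>)) \<le>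
        ennreal (q * s powr (q - 1)) * (ennreal (c / s\<^sup>2) * (\<integral>\<^sup>+x. ennreal (if G x \<le> ?h then (G x)\<^sup>2 else 0) \<partial>M))"
        by (rule mult_left_mono[OF D[OF True]]) simp
      also have "\<dots> = (\<integral>\<^sup>+x. ennreal (q * c * s powr (q - 2 - 1)) * ennreal (if G x \<le> ?h then (G x)\<^sup>2 else 0) \<partial>M)"
        using True q2 c
        by (simp only: e[symmetric]) (simp add: nn_integral_cmult ennreal_mult_left_assoc)
      also have "\<dots> = (\<integral>\<^sup>+x. k s x \<partial>M)"
        using True q2 c
        by (auto intro!: nn_integral_cong simp: k_def mult_ac simp flip: ennreal_mult)
      finally show ?thesis using True by simp
    qed simp
  qed
  also have "\<dots> = (\<integral>\<^sup>+x. \<integral>\<^sup>+s. k s x \<partial>lborel \<partial>M)"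
    by (subst P.Fubini'[symmetric]) auto
  also have "\<dots> = (\<integral>\<^sup>+x. ennreal (q * c / (q - 2) * (2 * N) powr (q - 2)) * ennreal (G x powr p) \<partial>M)"
  proof (intro nn_integral_cong)
    fix x
    show "(\<integral>\<^sup>+s. k s x \<partial>lborel) =
       ennreal (q * c / (q - 2) * (2 * N) powr (q - 2)) * ennreal (G x powr p)"
    proof (cases "G x = 0")
      case True
      then have "k s x = 0" for s by (auto simp: k_def)
      then show ?thesis using True by simp
    next
      case False
      then have G0: "G x > 0" using Gnn[of x] by simp
      let ?b = "2 * N * G x powr (1 - p)"
      \<comment> \<open>The cut condition is solved for \<open>s\<close> by applying the decreasing
        map \<open>y powr (1 - p)\<close> to both sides.\<close>
      have iff: "G x \<le> (s / (2 * N)) powr (- (1 / (p - 1))) \<longleftrightarrow> s \<le> ?b" if "s > 0" for s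
      proof -
        have e0: "- (1 / (p - 1)) * (1 - p) = 1" using p by (simp add: field_simps)
        have "G x \<le> (s / (2 * N)) powr (- (1 / (p - 1))) \<longleftrightarrow>
           ((s / (2 * N)) powr (- (1 / (p - 1)))) powr (1 - p) \<le> G x powr (1 - p)"
          using G0 that p N by (intro powr_neg_le_iff[symmetric]) auto
        also have "((s / (2 * N)) powr (- (1 / (p - 1)))) powr (1 - p) = s / (2 * N)"
          using that N e0 by (simp only: powr_powr) simp
        finally show ?thesis using N by (simp add: field_simps)
      qed
      have "(\<integral>\<^sup>+s. k s x \<partial>lborel) =
        (\<integral>\<^sup>+s. ennreal (q * c * (G x)\<^sup>2) * (ennreal (s powr (q - 2 - 1)) * indicator {0..?b} s) \<partial>lborel)"
        using q2 c G0 by (intro nn_integral_cong) (auto simp: k_def iff ennreal_mult indicator_def)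
      also have "\<dots> = ennreal (q * c * (G x)\<^sup>2) * ennreal (?b powr (q - 2) / (q - 2))"
        using q2 G0 N by (subst nn_integral_cmult, measurable)
          (subst nn_integral_powr_atLeastAtMost, auto)
      also have "?b powr (q - 2) = (2 * N) powr (q - 2) * G x powr (p - 2)"
        using N by (simp add: powr_mult powr_powr qp)
      also have "ennreal (q * c * (G x)\<^sup>2) * ennreal ((2 * N) powr (q - 2) * G x powr (p - 2) / (q - 2))
         = ennreal (q * c / (q - 2) * (2 * N) powr (q - 2) * G x powr p)"
        using q2 c G0 N by (subst ennreal_mult[symmetric]) (auto simp: powr_diff mult_ac)
      finally show ?thesis
        using q2 c N by (simp flip: ennreal_mult)
    qed
  qed
  also have "\<dots> = ennreal (q * c / (q - 2) * (2 * N) powr (q - 2)) * ennreal N"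
    unfolding N(2)[symmetric] by (rule nn_integral_cmult) auto
  \<comment> \<open>The factor \<open>N\<close> from the integral joins
    \<open>N powr (q - 2)\<close> from the cut height to make \<open>N powr (q - 1)\<close>.\<close>
  also have "\<dots> = ennreal (q * c / (q - 2) * 2 powr (q - 2) * N powr (q - 1))"
    using q2 c N powr_add[of N 1 "q - 2"]
    by (subst ennreal_mult[symmetric]) (auto simp: powr_mult mult_ac)
  finally show ?thesis
    using q2 c N by (subst (asm) ennreal_le_iff) auto
qed

section \<open>Square-integrable functions and Bessel's inequality\<close>

lemma in_Lp_2_iff: "in_Lp M 2 f \<longleftrightarrow> f \<in> borel_measurable M \<and> integrable M (\<lambda>x. (norm (f x))\<^sup>2)"
  by (simp add: in_Lp_def)

lemma Lp_norm_2_squared: "(Lp_norm M 2 f)\<^sup>2 = (\<integral>x. (norm (f x))\<^sup>2 \<partial>M)"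
proof -
  have "(\<integral>x. (norm (f x))\<^sup>2 \<partial>M) \<ge> 0" by simp
  then show ?thesis
    by (simp add: Lp_norm_def powr_half_sqrt)
qed

text \<open>A function of L^2 norm one is not zero almost everywhere, so its essential supremum is
  positive; with finiteness it is a genuine real number, and \<open>real_of_ereal\<close> in
  \<open>Linf_norm\<close> does not fall back on a default value.\<close>

lemma Linf_norm_normalized:
  assumes inf: "in_Linf M f" and L2: "in_Lp M 2 f" and one: "Lp_norm M 2 f = 1"
  shows "AE x in M. norm (f x) \<le> Linf_norm M f" "Linf_norm M f > 0"
proof -
  let ?E = "esssup M (\<lambda>x. ereal (norm (f x)))"
  have ae: "AE x in M. ereal (norm (f x)) \<le> ?E" by (rule esssup_AE)
  have "\<not> ?E \<le> 0"
  proof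
    assume "?E \<le> 0"
    have "AE x in M. (norm (f x))\<^sup>2 = 0"
      using ae
    proof eventually_elim
      case (elim x)
      then have "ereal (norm (f x)) \<le> 0" using \<open>?E \<le> 0\<close> by (rule order_trans)
      then show ?case by simp
    qed
    then have "(\<integral>x. (norm (f x))\<^sup>2 \<partial>M) = 0" by (rule integral_eq_zero_AE)
    then have "(Lp_norm M 2 f)\<^sup>2 = 0" by (simp only: Lp_norm_2_squared)
    with one show False by simp
  qed
  moreover have "?E < \<infinity>" using inf by (simp add: in_Linf_def)
  ultimately obtain r where r: "?E = ereal r" "r > 0" by (cases ?E) auto
  then have eq: "Linf_norm M f = r" by (simp add: Linf_norm_def)
  show "Linf_norm M f > 0" using r eq by simp
  show "AE x in M. norm (f x) \<le> Linf_norm M f" using ae unfolding eq r(1) by simp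
qed

lemma borel_measurable_cnj [measurable (raw)]:
  "f \<in> borel_measurable M \<Longrightarrow> (\<lambda>x. cnj (f x)) \<in> borel_measurable M"
  by (rule borel_measurable_continuous_on[where f = cnj]) (intro continuous_intros)

lemma integrable_mult_cnj_L1_Linf:
  fixes f g :: "'a \<Rightarrow> complex"
  assumes f: "integrable M f" and g [measurable]: "g \<in> borel_measurable M" and U: "AE x in M. norm (g x) \<le> U"
  shows "integrable M (\<lambda>x. f x * cnj (g x))"
    and "norm (\<integral>x. f x * cnj (g x) \<partial>M) \<le> U * (\<integral>x. norm (f x) \<partial>M)"
proof -
  have [measurable]: "f \<in> borel_measurable M" using f by simp
  have i: "integrable M (\<lambda>x. U * norm (f x))" using f by simp
  have ae: "AE x in M. norm (f x * cnj (g x)) \<le> U * norm (f x)"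
    using U by eventually_elim (metis complex_mod_cnj mult.commute mult_right_mono norm_ge_zero norm_mult)
  show int: "integrable M (\<lambda>x. f x * cnj (g x))"
    by (rule Bochner_Integration.integrable_bound[OF i])
       (use ae in \<open>auto elim!: eventually_mono\<close>)
  have "norm (\<integral>x. f x * cnj (g x) \<partial>M) \<le> (\<integral>x. norm (f x * cnj (g x)) \<partial>M)"
    by (rule integral_norm_bound)
  also have "\<dots> \<le> (\<integral>x. U * norm (f x) \<partial>M)"
    using int i ae by (intro integral_mono_AE) auto
  finally show "norm (\<integral>x. f x * cnj (g x) \<partial>M) \<le> U * (\<integral>x. norm (f x) \<partial>M)" by simp
qed

text \<open>Expand \<open>(B * x - y)\<^sup>2 \<ge> 0\<close>. With \<open>B\<close> the upper Riesz
  constant this replaces Cauchy-Schwarz in the duality argument and avoids square roots.\<close>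

lemma mult_le_weighted_squares:
  fixes x y :: real
  assumes "B > 0"
  shows "x * y \<le> (B * x\<^sup>2 + y\<^sup>2 / B) / 2"
proof -
  have "0 \<le> (B * x - y)\<^sup>2 / B" using assms by simp
  also have "\<dots> = B * x\<^sup>2 + y\<^sup>2 / B - 2 * (x * y)"
    using assms by (simp add: power2_eq_square field_simps)
  finally show ?thesis by simp
qed

lemma integrable_mult_cnj_L2:
  assumes f: "in_Lp M 2 f" and g: "in_Lp M 2 g"
  shows "integrable M (\<lambda>x. f x * cnj (g x))"
proof -
  have [measurable]: "f \<in> borel_measurable M" "g \<in> borel_measurable M"
    using f g by (auto simp: in_Lp_2_iff)
  have "integrable M (\<lambda>x. (norm (f x))\<^sup>2 + (norm (g x))\<^sup>2)"
    using f g by (auto simp: in_Lp_2_iff)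
  then show ?thesis
    by (rule Bochner_Integration.integrable_bound)
       (measurable, auto simp: norm_mult intro!: order_trans[OF mult_le_weighted_squares[of 1]])
qed

lemma in_Lp_2_sum:
  assumes "\<And>\<xi>. in_Lp M 2 (u \<xi>)" "finite F"
  shows "in_Lp M 2 (\<lambda>x. \<Sum>\<xi>\<in>F. c \<xi> * u \<xi> x)"
  using assms(2)
proof (induction F rule: finite_induct)
  case empty
  then show ?case by (simp add: in_Lp_def)
next
  case (insert \<xi> F)
  have [measurable]: "\<And>\<xi>. u \<xi> \<in> borel_measurable M" using assms(1) by (simp add: in_Lp_2_iff)
  let ?g = "\<lambda>x. \<Sum>\<xi>\<in>F. c \<xi> * u \<xi> x"
  have i: "integrable M (\<lambda>x. 2 * (norm (c \<xi>))\<^sup>2 * (norm (u \<xi> x))\<^sup>2 + 2 * (norm (?g x))\<^sup>2)"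
    using insert.IH assms(1)[of \<xi>] by (auto simp: in_Lp_2_iff)
  have "(norm (c \<xi> * u \<xi> x + ?g x))\<^sup>2 \<le> 2 * (norm (c \<xi>))\<^sup>2 * (norm (u \<xi> x))\<^sup>2 + 2 * (norm (?g x))\<^sup>2" for x
  proof -
    let ?a = "norm (c \<xi> * u \<xi> x)" and ?b = "norm (?g x)"
    have "(norm (c \<xi> * u \<xi> x + ?g x))\<^sup>2 \<le> (?a + ?b)\<^sup>2"
      by (intro power_mono norm_triangle_ineq) simp
    also have "\<dots> \<le> 2 * ?a\<^sup>2 + 2 * ?b\<^sup>2"
      using sum_squares_bound[of ?a ?b] by (simp add: power2_sum)
    finally show ?thesis by (simp add: norm_mult power_mult_distrib)
  qed
  then have "integrable M (\<lambda>x. (norm (c \<xi> * u \<xi> x + ?g x))\<^sup>2)"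
    by (intro Bochner_Integration.integrable_bound[OF i]) auto
  then show ?case using insert.hyps by (simp add: in_Lp_2_iff)
qed

text \<open>Duality: testing \<open>f\<close> against \<open>\<Sum> c \<xi> u \<xi>\<close> with \<open>c \<xi>\<close> the coefficients of \<open>f\<close> itself.\<close>

lemma riesz_upper_imp_bessel:
  assumes u: "\<And>\<xi>. in_Lp M 2 (u \<xi>)" and B: "B > 0"
    and upper: "\<And>F c. finite F \<Longrightarrow>
        (Lp_norm M 2 (\<lambda>x. \<Sum>\<xi>\<in>F. c \<xi> * u \<xi> x))\<^sup>2 \<le> B * (\<Sum>\<xi>\<in>F. (norm (c \<xi>))\<^sup>2)"
    and f: "in_Lp M 2 f" and F: "finite F"
  shows "(\<Sum>\<xi>\<in>F. (norm (FL_star M u f \<xi>))\<^sup>2) \<le> B * (\<integral>x. (norm (f x))\<^sup>2 \<partial>M)"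
proof -
  define c where "c = FL_star M u f"
  define g where "g x = (\<Sum>\<xi>\<in>F. c \<xi> * u \<xi> x)" for x
  let ?X = "\<Sum>\<xi>\<in>F. (norm (c \<xi>))\<^sup>2"
  have g: "in_Lp M 2 g" unfolding g_def using u F by (rule in_Lp_2_sum)
  have "(\<integral>x. f x * cnj (g x) \<partial>M) = (\<integral>x. (\<Sum>\<xi>\<in>F. cnj (c \<xi>) * (f x * cnj (u \<xi> x))) \<partial>M)"
    by (simp add: g_def sum_distrib_left mult_ac)
  also have "\<dots> = (\<Sum>\<xi>\<in>F. cnj (c \<xi>) * c \<xi>)"
    using integrable_mult_cnj_L2[OF f u]
    by (subst Bochner_Integration.integral_sum) (auto simp: c_def FL_star_def)
  also have "\<dots> = complex_of_real ?X"
    by (simp add: complex_norm_square mult.commute del: of_real_power)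
  finally have "?X = norm (\<integral>x. f x * cnj (g x) \<partial>M)"
    by (simp add: sum_nonneg del: of_real_sum)
  also have "\<dots> \<le> (\<integral>x. norm (f x * cnj (g x)) \<partial>M)"
    by (rule integral_norm_bound)
  also have "\<dots> \<le> (\<integral>x. (B * (norm (f x))\<^sup>2 + (norm (g x))\<^sup>2 / B) / 2 \<partial>M)"
    using f g integrable_norm[OF integrable_mult_cnj_L2[OF f g]] mult_le_weighted_squares[OF B]
    by (intro integral_mono) (auto simp: in_Lp_2_iff norm_mult)
  also have "\<dots> = (B * (\<integral>x. (norm (f x))\<^sup>2 \<partial>M) + (Lp_norm M 2 g)\<^sup>2 / B) / 2"
    unfolding Lp_norm_2_squared using f g by (auto simp: in_Lp_2_iff)
  \<comment> \<open>The Riesz bound gives \<open>(Lp_norm M 2 g)\<^sup>2 / B \<le> ?X\<close>. Half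
    of \<open>?X\<close> then stands on the right and is absorbed on the left.\<close>
  also have "\<dots> \<le> (B * (\<integral>x. (norm (f x))\<^sup>2 \<partial>M) + ?X) / 2"
    using upper[OF F, of c] B by (simp add: g_def[abs_def] field_simps)
  finally show ?thesis by (simp add: c_def)
qed

section \<open>Truncation at a fixed height\<close>

text \<open>Both parts are compared pointwise with a multiple of \<open>norm (f x) powr p\<close>:
  above \<open>h\<close> the factor \<open>norm (f x) powr (1 - p)\<close> is at most
  \<open>h powr (1 - p)\<close>, and below \<open>h\<close> the factor
  \<open>norm (f x) powr (2 - p)\<close> is at most \<open>h powr (2 - p)\<close>.\<close>

lemma in_Lp_truncation:
  assumes f: "in_Lp M p f" and p: "1 < p" "p \<le> 2" and h: "h > 0"
  shows "integrable M (\<lambda>x. if h < norm (f x) then f x else 0)"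
    and "(\<integral>x. norm (if h < norm (f x) then f x else 0) \<partial>M) \<le> h powr (1 - p) * (\<integral>x. norm (f x) powr p \<partial>M)"
    and "in_Lp M 2 (\<lambda>x. if norm (f x) \<le> h then f x else 0)"
proof -
  have [measurable]: "f \<in> borel_measurable M" and i: "integrable M (\<lambda>x. norm (f x) powr p)"
    using f by (auto simp: in_Lp_def)
  have i1: "integrable M (\<lambda>x. h powr (1 - p) * norm (f x) powr p)"
    and i2: "integrable M (\<lambda>x. h powr (2 - p) * norm (f x) powr p)"
    using i by auto
  have b1: "norm (if h < norm (f x) then f x else 0) \<le> h powr (1 - p) * norm (f x) powr p" for x
  proof (cases "h < norm (f x)")
    case True
    then have "norm (f x) powr (1 - p) * norm (f x) powr p \<le> h powr (1 - p) * norm (f x) powr p"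
      using h p by (intro mult_right_mono powr_mono2') auto
    also have "norm (f x) powr (1 - p) * norm (f x) powr p = norm (f x)"
      using True h by (simp flip: powr_add)
    finally show ?thesis using True by simp
  qed simp
  have b2: "(norm (if norm (f x) \<le> h then f x else 0))\<^sup>2 \<le> h powr (2 - p) * norm (f x) powr p" for x
  proof (cases "norm (f x) \<le> h \<and> f x \<noteq> 0")
    case True
    then have "norm (f x) powr (2 - p) * norm (f x) powr p \<le> h powr (2 - p) * norm (f x) powr p"
      using h p by (intro mult_right_mono powr_mono2) auto
    also have "norm (f x) powr (2 - p) * norm (f x) powr p = (norm (f x))\<^sup>2"
      using True by (simp flip: powr_add)
    finally show ?thesis using True by simp
  qed auto
  show int: "integrable M (\<lambda>x. if h < norm (f x) then f x else 0)"
    by (rule Bochner_Integration.integrable_bound[OF i1])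
       (measurable, use b1 in \<open>simp add: abs_mult\<close>)
  show "(\<integral>x. norm (if h < norm (f x) then f x else 0) \<partial>M) \<le> h powr (1 - p) * (\<integral>x. norm (f x) powr p \<partial>M)"
    using integral_mono[OF integrable_norm[OF int] i1 b1] by simp
  have "integrable M (\<lambda>x. (norm (if norm (f x) \<le> h then f x else 0))\<^sup>2)"
    by (rule Bochner_Integration.integrable_bound[OF i2])
       (measurable, use b2 in \<open>simp add: abs_mult\<close>)
  then show "in_Lp M 2 (\<lambda>x. if norm (f x) \<le> h then f x else 0)"
    by (simp add: in_Lp_2_iff)
qed

section \<open>Systems with a sup bound and a Bessel bound\<close>

text \<open>Collects the two endpoint bounds behind the interpolation: \<open>u_le\<close> controls
  coefficients of L^1 functions by \<open>U\<close>, and \<open>bessel\<close> maps L^2 to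
  square-summable sequences.\<close>

locale bounded_bessel_system = sigma_finite_measure M for M :: "'a measure" +
  fixes u :: "'i \<Rightarrow> 'a \<Rightarrow> complex" and U :: "'i \<Rightarrow> real" and B :: real
  assumes u_L2: "in_Lp M 2 (u \<xi>)"
    and u_le: "AE x in M. norm (u \<xi> x) \<le> U \<xi>"
    and U_pos: "U \<xi> > 0"
    and B_pos: "B > 0"
    and bessel: "in_Lp M 2 f \<Longrightarrow> finite F \<Longrightarrow>
      (\<Sum>\<xi>\<in>F. (norm (FL_star M u f \<xi>))\<^sup>2) \<le> B * (\<integral>x. (norm (f x))\<^sup>2 \<partial>M)"
begin

text \<open>The high part lies in L^1 and is estimated at once by the sup bound on
  \<open>u \<xi>\<close>; the low part lies in L^2 and keeps its coefficient, to be summed later by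
  \<open>bessel\<close>.\<close>

lemma FL_star_truncation_le:
  assumes f: "in_Lp M p f" and p: "1 < p" "p \<le> 2" and h: "h > 0"
  shows "norm (FL_star M u f \<xi>) \<le>
    U \<xi> * (\<integral>x. norm (if h < norm (f x) then f x else 0) \<partial>M) +
    norm (FL_star M u (\<lambda>x. if norm (f x) \<le> h then f x else 0) \<xi>)"
proof -
  let ?f1 = "\<lambda>x. if h < norm (f x) then f x else 0" and ?f2 = "\<lambda>x. if norm (f x) \<le> h then f x else 0"
  have m: "u \<xi> \<in> borel_measurable M" using u_L2 by (simp add: in_Lp_2_iff)
  note t = in_Lp_truncation[OF f p h]
  have "FL_star M u f \<xi> = (\<integral>x. ?f1 x * cnj (u \<xi> x) + ?f2 x * cnj (u \<xi> x) \<partial>M)"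
    unfolding FL_star_def by (intro Bochner_Integration.integral_cong) auto
  also have "\<dots> = FL_star M u ?f1 \<xi> + FL_star M u ?f2 \<xi>"
    unfolding FL_star_def
    by (rule Bochner_Integration.integral_add
        [OF integrable_mult_cnj_L1_Linf(1)[OF t(1) m u_le] integrable_mult_cnj_L2[OF t(3) u_L2]])
  finally have "norm (FL_star M u f \<xi>) \<le> norm (FL_star M u ?f1 \<xi>) + norm (FL_star M u ?f2 \<xi>)"
    using norm_triangle_ineq by metis
  moreover have "norm (FL_star M u ?f1 \<xi>) \<le> U \<xi> * (\<integral>x. norm (?f1 x) \<partial>M)"
    unfolding FL_star_def by (rule integrable_mult_cnj_L1_Linf(2)[OF t(1) m u_le])
  ultimately show ?thesis by simp
qed

text \<open>Translates between the nonnegative integrals of the interpolation lemmas and the Bochner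
  integrals of the coefficient bounds.\<close>

lemma nn_integral_truncation:
  assumes f: "in_Lp M p f" and p: "1 < p" "p \<le> 2" and h: "h > 0"
  shows "(\<integral>\<^sup>+x. ennreal (if h < norm (f x) then norm (f x) else 0) \<partial>M) =
      ennreal (\<integral>x. norm (if h < norm (f x) then f x else 0) \<partial>M)"
    and "(\<integral>\<^sup>+x. ennreal (if norm (f x) \<le> h then (norm (f x))\<^sup>2 else 0) \<partial>M) =
      ennreal (\<integral>x. (norm (if norm (f x) \<le> h then f x else 0))\<^sup>2 \<partial>M)"
proof -
  note t = in_Lp_truncation[OF f p h]
  show "(\<integral>\<^sup>+x. ennreal (if h < norm (f x) then norm (f x) else 0) \<partial>M) =
      ennreal (\<integral>x. norm (if h < norm (f x) then f x else 0) \<partial>M)"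
    using integrable_norm[OF t(1)]
    by (subst nn_integral_eq_integral[symmetric]) (auto intro!: nn_integral_cong)
  show "(\<integral>\<^sup>+x. ennreal (if norm (f x) \<le> h then (norm (f x))\<^sup>2 else 0) \<partial>M) =
      ennreal (\<integral>x. (norm (if norm (f x) \<le> h then f x else 0))\<^sup>2 \<partial>M)"
    using t(3) unfolding in_Lp_2_iff
    by (subst nn_integral_eq_integral[symmetric]) (auto intro!: nn_integral_cong)
qed

section \<open>The Paley and Hausdorff-Young endpoints\<close>

text \<open>Marcinkiewicz applied to coefficients divided by \<open>\<phi> \<xi> * w \<xi>\<close>
  under the weights \<open>(\<phi> \<xi> * w \<xi>)\<^sup>2\<close>, with the weak bound on
  \<open>\<phi>\<close> scaled to 1. The comparison \<open>U \<xi> \<le> K * w \<xi>\<close> lets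
  the sup bound on \<open>u\<close> be measured in terms of \<open>w\<close>.\<close>

lemma paley_normalized:
  assumes f: "in_Lp M p f" and p: "1 < p" "p < 2" and F: "finite F"
    and w: "\<And>\<xi>. w \<xi> > 0" and K: "K > 0" "\<And>\<xi>. U \<xi> \<le> K * w \<xi>" and \<phi>: "\<And>\<xi>. \<phi> \<xi> > 0"
    and weak: "\<And>t. t > 0 \<Longrightarrow> t * (\<Sum>\<xi>\<in>{\<xi>\<in>F. t \<le> \<phi> \<xi>}. (w \<xi>)\<^sup>2) \<le> 1"
  shows "(\<Sum>\<xi>\<in>F. norm (FL_star M u f \<xi>) powr p * (\<phi> \<xi> * w \<xi>) powr (2 - p)) \<le>
    (p * (4 * K) / (p - 1) + p * (4 * B) / (2 - p)) * (\<integral>x. norm (f x) powr p \<partial>M)"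
proof -
  let ?F = "\<lambda>\<xi>. norm (FL_star M u f \<xi>)"
  have fm [measurable]: "f \<in> borel_measurable M" and i: "integrable M (\<lambda>x. norm (f x) powr p)"
    using f by (auto simp: in_Lp_def)
  have \<phi>w: "\<phi> \<xi> * w \<xi> > 0" for \<xi> using \<phi> w by simp
  then have nn: "?F \<xi> / (\<phi> \<xi> * w \<xi>) \<ge> 0" for \<xi> by (simp add: less_imp_le)
  have "ennreal (\<Sum>\<xi>\<in>F. (\<phi> \<xi> * w \<xi>)\<^sup>2 * (?F \<xi> / (\<phi> \<xi> * w \<xi>)) powr p) \<le>
    ennreal (p * (4 * K) / (p - 1) + p * (4 * B) / (2 - p)) * (\<integral>\<^sup>+x. ennreal (norm (f x) powr p) \<partial>M)"
  proof (rule paley_interpolation)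
    fix s :: real assume s: "s > 0"
    \<comment> \<open>Split \<open>f\<close> at height \<open>s\<close>: if \<open>\<phi> \<xi> \<ge> R\<close>, the high part cannot account for more than half of \<open>s * (\<phi> \<xi> * w \<xi>)\<close>.\<close>
    define A1 where "A1 = (\<integral>x. norm (if s < norm (f x) then f x else 0) \<partial>M)"
    define f2 where "f2 = (\<lambda>x. if norm (f x) \<le> s then f x else 0)"
    define A2 where "A2 = (\<integral>x. (norm (f2 x))\<^sup>2 \<partial>M)"
    define R where "R = 2 * K * A1 / s"
    have A: "A1 \<ge> 0" "A2 \<ge> 0" by (simp_all add: A1_def A2_def)
    have c: "4 * K / s \<ge> 0" "4 * B / s\<^sup>2 \<ge> 0" using K B_pos s by auto
    have R: "R \<ge> 0" using A K s by (simp add: R_def)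
    \<comment> \<open>An index of the level set either has \<open>\<phi> \<xi> < R\<close> and is
      paid for by the first term, or its low-part coefficient is at least
      \<open>s * (\<phi> \<xi> * w \<xi>) / 2\<close>, and Chebyshev gives the second.\<close>
    have pt: "(\<phi> \<xi> * w \<xi>)\<^sup>2 * of_bool (s < ?F \<xi> / (\<phi> \<xi> * w \<xi>)) \<le>
      (\<phi> \<xi> * w \<xi>)\<^sup>2 * of_bool (\<phi> \<xi> < R) + 4 / s\<^sup>2 * (norm (FL_star M u f2 \<xi>))\<^sup>2" for \<xi>
    proof (cases "s < ?F \<xi> / (\<phi> \<xi> * w \<xi>) \<and> \<not> \<phi> \<xi> < R")
      case True
      then have "s * (\<phi> \<xi> * w \<xi>) < ?F \<xi>" using \<phi>w[of \<xi>] by (simp add: pos_less_divide_eq)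
      also have "\<dots> \<le> U \<xi> * A1 + norm (FL_star M u f2 \<xi>)"
        using FL_star_truncation_le[OF f _ _ s] p by (simp add: A1_def f2_def)
      also have "U \<xi> * A1 \<le> K * w \<xi> * A1" using K A by (intro mult_right_mono) auto
      also have "\<dots> = (s * R) * w \<xi> / 2" using s by (simp add: R_def)
      also have "\<dots> \<le> (s * \<phi> \<xi>) * w \<xi> / 2"
        using True s w[of \<xi>] by (intro divide_right_mono mult_right_mono mult_left_mono) auto
      finally have "s * (\<phi> \<xi> * w \<xi>) \<le> 2 * norm (FL_star M u f2 \<xi>)" by simp
      then have "(s * (\<phi> \<xi> * w \<xi>))\<^sup>2 \<le> (2 * norm (FL_star M u f2 \<xi>))\<^sup>2"
        using s \<phi>w[of \<xi>] by (intro power_mono) auto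
      then show ?thesis using True s by (simp add: power_mult_distrib field_simps)
    qed auto
    have "(\<Sum>\<xi>\<in>F. (\<phi> \<xi> * w \<xi>)\<^sup>2 * of_bool (s < ?F \<xi> / (\<phi> \<xi> * w \<xi>))) \<le>
      (\<Sum>\<xi>\<in>F. (\<phi> \<xi> * w \<xi>)\<^sup>2 * of_bool (\<phi> \<xi> < R)) + 4 / s\<^sup>2 * (\<Sum>\<xi>\<in>F. (norm (FL_star M u f2 \<xi>))\<^sup>2)"
      unfolding sum_distrib_left sum.distrib[symmetric] by (intro sum_mono pt)
    also have "(\<Sum>\<xi>\<in>F. (\<phi> \<xi> * w \<xi>)\<^sup>2 * of_bool (\<phi> \<xi> < R)) = (\<Sum>\<xi>\<in>{\<xi>\<in>F. \<phi> \<xi> < R}. (\<phi> \<xi> * w \<xi>)\<^sup>2)"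
      by (rule sum.mono_neutral_cong_right) (use F in auto)
    \<comment> \<open>This is the weak (1,1) term, \<open>2 * R = 4 * K * A1 / s\<close>; Bessel on
      the low part then supplies the weak (2,2) term.\<close>
    also have "\<dots> \<le> 2 * R" by (rule sum_small_weights_le[OF F \<phi> R weak])
    also have "(\<Sum>\<xi>\<in>F. (norm (FL_star M u f2 \<xi>))\<^sup>2) \<le> B * A2"
      using in_Lp_truncation(3)[OF f _ _ s] p F unfolding A2_def by (intro bessel) (auto simp: f2_def)
    finally have "(\<Sum>\<xi>\<in>F. (\<phi> \<xi> * w \<xi>)\<^sup>2 * of_bool (s < ?F \<xi> / (\<phi> \<xi> * w \<xi>))) \<le>
      4 * K / s * A1 + 4 * B / s\<^sup>2 * A2"
      by (simp add: R_def mult_ac divide_right_mono)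
    then have "ennreal (\<Sum>\<xi>\<in>F. (\<phi> \<xi> * w \<xi>)\<^sup>2 * of_bool (s < ?F \<xi> / (\<phi> \<xi> * w \<xi>))) \<le>
      ennreal (4 * K / s * A1 + 4 * B / s\<^sup>2 * A2)"
      by (rule ennreal_leI)
    also have "\<dots> = ennreal (4 * K / s) * ennreal A1 + ennreal (4 * B / s\<^sup>2) * ennreal A2"
      using A c by (simp only: ennreal_plus ennreal_mult mult_nonneg_nonneg)
    finally show "ennreal (\<Sum>\<xi>\<in>F. (\<phi> \<xi> * w \<xi>)\<^sup>2 * of_bool (s < ?F \<xi> / (\<phi> \<xi> * w \<xi>))) \<le>
      ennreal (4 * K / s) * (\<integral>\<^sup>+x. ennreal (if s < norm (f x) then norm (f x) else 0) \<partial>M) +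
      ennreal (4 * B / s\<^sup>2) * (\<integral>\<^sup>+x. ennreal (if norm (f x) \<le> s then (norm (f x))\<^sup>2 else 0) \<partial>M)"
      using nn_integral_truncation[OF f _ _ s] p by (simp add: A1_def A2_def f2_def)
  qed (use p F K B_pos nn in \<open>auto intro: sigma_finite_measure_axioms less_imp_le\<close>)
  also have "\<dots> = ennreal ((p * (4 * K) / (p - 1) + p * (4 * B) / (2 - p)) * (\<integral>x. norm (f x) powr p \<partial>M))"
    using p K B_pos by (subst nn_integral_eq_integral[OF i]) (auto simp: ennreal_mult)
  finally have "(\<Sum>\<xi>\<in>F. (\<phi> \<xi> * w \<xi>)\<^sup>2 * (?F \<xi> / (\<phi> \<xi> * w \<xi>)) powr p) \<le>
    (p * (4 * K) / (p - 1) + p * (4 * B) / (2 - p)) * (\<integral>x. norm (f x) powr p \<partial>M)"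
    using p K B_pos by (subst (asm) ennreal_le_iff) (auto intro!: add_nonneg_nonneg mult_nonneg_nonneg divide_nonneg_pos)
  moreover have "(\<phi> \<xi> * w \<xi>)\<^sup>2 * (?F \<xi> / (\<phi> \<xi> * w \<xi>)) powr p = ?F \<xi> powr p * (\<phi> \<xi> * w \<xi>) powr (2 - p)" for \<xi>
    using \<phi>w[of \<xi>] by (simp add: powr_divide powr_diff)
  ultimately show ?thesis by simp
qed

text \<open>Dividing by \<open>U \<xi>\<close> makes the high-part bound uniform in
  \<open>\<xi>\<close>, so one cut height serves all indices. The weights
  \<open>(U \<xi>)\<^sup>2\<close> undo this division in the L^2 estimate.\<close>

lemma hausdorff_young_lt_2:
  assumes f: "in_Lp M p f" and p: "1 < p" "p < 2" and q: "q = p / (p - 1)" and F: "finite F"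
    and N: "(\<integral>x. norm (f x) powr p \<partial>M) = N" "N > 0"
  shows "(\<Sum>\<xi>\<in>F. norm (FL_star M u f \<xi>) powr q * U \<xi> powr (2 - q)) \<le>
    q * (4 * B) / (q - 2) * 2 powr (q - 2) * N powr (q - 1)"
proof -
  let ?F = "\<lambda>\<xi>. norm (FL_star M u f \<xi>)"
  have fm [measurable]: "f \<in> borel_measurable M" and i: "integrable M (\<lambda>x. norm (f x) powr p)"
    using f by (auto simp: in_Lp_def)
  have nn: "?F \<xi> / U \<xi> \<ge> 0" for \<xi> using U_pos[of \<xi>] by simp
  have "(\<Sum>\<xi>\<in>F. (U \<xi>)\<^sup>2 * (?F \<xi> / U \<xi>) powr q) \<le> q * (4 * B) / (q - 2) * 2 powr (q - 2) * N powr (q - 1)"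
  proof (rule hausdorff_young_interpolation)
    show "(\<integral>\<^sup>+x. ennreal (norm (f x) powr p) \<partial>M) = ennreal N"
      by (subst nn_integral_eq_integral[OF i]) (auto simp: N)
    fix s :: real assume s: "s > 0"
    \<comment> \<open>Chosen so that \<open>h powr (1 - p) * N = s / 2\<close>: then the part of \<open>f\<close> above \<open>h\<close> has \<open>L\<^sup>1\<close> norm at most \<open>s / 2\<close>.\<close>
    define h where "h = (s / (2 * N)) powr (- (1 / (p - 1)))"
    have h: "h > 0" using s N by (simp add: h_def)
    define f2 where "f2 = (\<lambda>x. if norm (f x) \<le> h then f x else 0)"
    define A2 where "A2 = (\<integral>x. (norm (f2 x))\<^sup>2 \<partial>M)"
    have A: "A2 \<ge> 0" by (simp add: A2_def)
    have e0: "- (1 / (p - 1)) * (1 - p) = 1" using p by (simp add: field_simps)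
    have "h powr (1 - p) = s / (2 * N)"
      unfolding h_def powr_powr e0 using s N by simp
    then have A1: "(\<integral>x. norm (if h < norm (f x) then f x else 0) \<partial>M) \<le> s / 2"
      using in_Lp_truncation(2)[OF f _ _ h] p N by simp
    \<comment> \<open>The high part contributes at most \<open>U \<xi> * (s / 2)\<close>, so on the
      level set the low part carries more than half of \<open>s * U \<xi>\<close>, with no
      exceptional indices.\<close>
    have pt: "(U \<xi>)\<^sup>2 * of_bool (s < ?F \<xi> / U \<xi>) \<le> 4 / s\<^sup>2 * (norm (FL_star M u f2 \<xi>))\<^sup>2" for \<xi>
    proof (cases "s < ?F \<xi> / U \<xi>")
      case True
      then have "s * U \<xi> < ?F \<xi>" using U_pos[of \<xi>] by (simp add: pos_less_divide_eq)
      also have "?F \<xi> \<le> U \<xi> * (\<integral>x. norm (if h < norm (f x) then f x else 0) \<partial>M) + norm (FL_star M u f2 \<xi>)"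
        using FL_star_truncation_le[OF f _ _ h] p by (simp add: f2_def)
      also have "U \<xi> * (\<integral>x. norm (if h < norm (f x) then f x else 0) \<partial>M) \<le> U \<xi> * (s / 2)"
        using U_pos[of \<xi>] A1 by (intro mult_left_mono) auto
      finally have "s * U \<xi> \<le> 2 * norm (FL_star M u f2 \<xi>)" by (simp add: mult.commute)
      then have "(s * U \<xi>)\<^sup>2 \<le> (2 * norm (FL_star M u f2 \<xi>))\<^sup>2"
        using s U_pos[of \<xi>] by (intro power_mono) auto
      then show ?thesis using True s by (simp add: power_mult_distrib field_simps)
    qed auto
    have "(\<Sum>\<xi>\<in>F. (U \<xi>)\<^sup>2 * of_bool (s < ?F \<xi> / U \<xi>)) \<le> 4 / s\<^sup>2 * (\<Sum>\<xi>\<in>F. (norm (FL_star M u f2 \<xi>))\<^sup>2)"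
      unfolding sum_distrib_left by (intro sum_mono pt)
    also have "(\<Sum>\<xi>\<in>F. (norm (FL_star M u f2 \<xi>))\<^sup>2) \<le> B * A2"
      using in_Lp_truncation(3)[OF f _ _ h] p F unfolding A2_def by (intro bessel) (auto simp: f2_def)
    finally have "(\<Sum>\<xi>\<in>F. (U \<xi>)\<^sup>2 * of_bool (s < ?F \<xi> / U \<xi>)) \<le> 4 * B / s\<^sup>2 * A2"
      by (simp add: mult_ac divide_right_mono)
    then have "ennreal (\<Sum>\<xi>\<in>F. (U \<xi>)\<^sup>2 * of_bool (s < ?F \<xi> / U \<xi>)) \<le> ennreal (4 * B / s\<^sup>2 * A2)"
      by (rule ennreal_leI)
    also have "\<dots> = ennreal (4 * B / s\<^sup>2) * ennreal A2"
      using A B_pos s by (intro ennreal_mult) auto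
    also have "ennreal A2 = (\<integral>\<^sup>+x. ennreal (if norm (f x) \<le> h then (norm (f x))\<^sup>2 else 0) \<partial>M)"
      using nn_integral_truncation(2)[OF f _ _ h] p by (simp add: A2_def f2_def)
    finally show "ennreal (\<Sum>\<xi>\<in>F. (U \<xi>)\<^sup>2 * of_bool (s < ?F \<xi> / U \<xi>)) \<le>
      ennreal (4 * B / s\<^sup>2) * (\<integral>\<^sup>+x. ennreal (if norm (f x) \<le> (s / (2 * N)) powr (- (1 / (p - 1))) then (norm (f x))\<^sup>2 else 0) \<partial>M)"
      unfolding h_def .
  qed (use p q F B_pos nn N in \<open>auto intro: sigma_finite_measure_axioms less_imp_le\<close>)
  moreover have "(U \<xi>)\<^sup>2 * (?F \<xi> / U \<xi>) powr q = ?F \<xi> powr q * U \<xi> powr (2 - q)" for \<xi>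
    using U_pos[of \<xi>] by (simp add: powr_divide powr_diff)
  ultimately show ?thesis by simp
qed

text \<open>For \<open>p < 2\<close>, replacing \<open>\<phi>\<close> by \<open>\<phi> / m\<close>
  reduces to the normalized case and produces \<open>m powr (2 - p)\<close>; \<open>p = 2\<close> is
  Bessel. The constant is fixed before \<open>f\<close>, \<open>F\<close>, \<open>\<phi>\<close> and
  \<open>m\<close>.\<close>

lemma paley:
  assumes p: "1 < p" "p \<le> 2"
    and w: "\<And>\<xi>. w \<xi> > 0" and K: "K > 0" "\<And>\<xi>. U \<xi> \<le> K * w \<xi>"
  obtains C where "C > 0"
    "\<And>f F \<phi> m. \<lbrakk>in_Lp M p f; finite F; \<And>\<xi>. \<phi> \<xi> > 0; m > 0;
       \<And>t. t > 0 \<Longrightarrow> t * (\<Sum>\<xi>\<in>{\<xi>\<in>F. t \<le> \<phi> \<xi>}. (w \<xi>)\<^sup>2) \<le> m\<rbrakk> \<Longrightarrow>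
     (\<Sum>\<xi>\<in>F. norm (FL_star M u f \<xi>) powr p * (\<phi> \<xi> * w \<xi>) powr (2 - p)) \<le>
       C * m powr (2 - p) * (\<integral>x. norm (f x) powr p \<partial>M)"
proof (cases "p = 2")
  case True
  show ?thesis
  proof (rule that[OF B_pos])
    fix f :: "'a \<Rightarrow> complex" and F :: "'i set" and \<phi> :: "'i \<Rightarrow> real" and m :: real
    assume "in_Lp M p f" "finite F" and \<phi>: "\<And>\<xi>. \<phi> \<xi> > 0" and "m > 0"
    \<comment> \<open>The exponent \<open>2 - p\<close> is 0 here, and \<open>x powr 0\<close>
      equals 1 only for \<open>x \<noteq> 0\<close>.\<close>
    moreover have "\<phi> \<xi> * w \<xi> \<noteq> 0" for \<xi> using \<phi>[of \<xi>] w[of \<xi>] by simp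
    ultimately show "(\<Sum>\<xi>\<in>F. norm (FL_star M u f \<xi>) powr p * (\<phi> \<xi> * w \<xi>) powr (2 - p)) \<le>
       B * m powr (2 - p) * (\<integral>x. norm (f x) powr p \<partial>M)"
      using bessel[of f F] True by simp
  qed
next
  case False
  with p have p2: "p < 2" by simp
  let ?C = "p * (4 * K) / (p - 1) + p * (4 * B) / (2 - p)"
  show ?thesis
  proof (rule that[of ?C])
    show "?C > 0" using p p2 K B_pos by (intro add_pos_pos divide_pos_pos mult_pos_pos) auto
    fix f :: "'a \<Rightarrow> complex" and F :: "'i set" and \<phi> :: "'i \<Rightarrow> real" and m :: real
    assume f: "in_Lp M p f" and F: "finite F" and \<phi>: "\<And>\<xi>. \<phi> \<xi> > 0" and m: "m > 0"
      and weak: "\<And>t. t > 0 \<Longrightarrow> t * (\<Sum>\<xi>\<in>{\<xi>\<in>F. t \<le> \<phi> \<xi>}. (w \<xi>)\<^sup>2) \<le> m"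
    have "t * (\<Sum>\<xi>\<in>{\<xi>\<in>F. t \<le> \<phi> \<xi> / m}. (w \<xi>)\<^sup>2) \<le> 1" if "t > 0" for t
      using weak[of "t * m"] that m by (simp add: pos_le_divide_eq mult_ac)
    then have "(\<Sum>\<xi>\<in>F. norm (FL_star M u f \<xi>) powr p * (\<phi> \<xi> / m * w \<xi>) powr (2 - p)) \<le>
       ?C * (\<integral>x. norm (f x) powr p \<partial>M)"
      using \<phi> m by (intro paley_normalized[OF f _ p2 F w K]) (use p in auto)
    moreover have "(\<phi> \<xi> / m * w \<xi>) powr (2 - p) = (\<phi> \<xi> * w \<xi>) powr (2 - p) / m powr (2 - p)" for \<xi>
      using \<phi>[of \<xi>] w[of \<xi>] m by (simp add: powr_mult powr_divide)
    ultimately have "(\<Sum>\<xi>\<in>F. norm (FL_star M u f \<xi>) powr p * (\<phi> \<xi> * w \<xi>) powr (2 - p)) / m powr (2 - p) \<le>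
       ?C * (\<integral>x. norm (f x) powr p \<partial>M)"
      by (simp only: times_divide_eq_right sum_divide_distrib)
    then show "(\<Sum>\<xi>\<in>F. norm (FL_star M u f \<xi>) powr p * (\<phi> \<xi> * w \<xi>) powr (2 - p)) \<le>
       ?C * m powr (2 - p) * (\<integral>x. norm (f x) powr p \<partial>M)"
      using m by (simp only: pos_divide_le_eq powr_gt_zero mult_ac)
  qed
qed

lemma FL_star_eq_0:
  assumes f: "in_Lp M p f" and "(\<integral>x. norm (f x) powr p \<partial>M) = 0"
  shows "FL_star M u f \<xi> = 0"
proof -
  have "AE x in M. norm (f x) powr p = 0"
    using assms by (subst (asm) integral_nonneg_eq_0_iff_AE) (auto simp: in_Lp_def)
  then have "AE x in M. f x * cnj (u \<xi> x) = 0" by eventually_elim simp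
  then show ?thesis unfolding FL_star_def by (rule integral_eq_zero_AE)
qed

lemma hausdorff_young:
  assumes p: "1 < p" "p \<le> 2" and q: "q = p / (p - 1)"
  obtains C where "C > 0"
    "\<And>f F. \<lbrakk>in_Lp M p f; finite F\<rbrakk> \<Longrightarrow>
     (\<Sum>\<xi>\<in>F. norm (FL_star M u f \<xi>) powr q * U \<xi> powr (2 - q)) \<le>
       C * (\<integral>x. norm (f x) powr p \<partial>M) powr (q - 1)"
proof (cases "p = 2")
  case True
  then have q2: "q = 2" by (simp add: q)
  show ?thesis
  proof (rule that[OF B_pos])
    fix f :: "'a \<Rightarrow> complex" and F :: "'i set"
    assume "in_Lp M p f" "finite F"
    moreover have "U \<xi> \<noteq> 0" for \<xi> using U_pos[of \<xi>] by simp
    ultimately show "(\<Sum>\<xi>\<in>F. norm (FL_star M u f \<xi>) powr q * U \<xi> powr (2 - q)) \<le>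
       B * (\<integral>x. norm (f x) powr p \<partial>M) powr (q - 1)"
      using bessel[of f F] True q2 by simp
  qed
next
  case False
  with p have p2: "p < 2" by simp
  then have q2: "q > 2" using p by (simp add: q field_simps)
  show ?thesis
  proof (rule that[of "q * (4 * B) / (q - 2) * 2 powr (q - 2)"])
    show "q * (4 * B) / (q - 2) * 2 powr (q - 2) > 0" using q2 B_pos by simp
    fix f :: "'a \<Rightarrow> complex" and F :: "'i set"
    assume f: "in_Lp M p f" and F: "finite F"
    \<comment> \<open>The cut height divides by this integral, so functions vanishing almost
      everywhere are treated apart.\<close>
    have "(\<integral>x. norm (f x) powr p \<partial>M) \<ge> 0" by simp
    then consider "(\<integral>x. norm (f x) powr p \<partial>M) = 0" | "(\<integral>x. norm (f x) powr p \<partial>M) > 0"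
      by linarith
    then show "(\<Sum>\<xi>\<in>F. norm (FL_star M u f \<xi>) powr q * U \<xi> powr (2 - q)) \<le>
       q * (4 * B) / (q - 2) * 2 powr (q - 2) * (\<integral>x. norm (f x) powr p \<partial>M) powr (q - 1)"
    proof cases
      case 1
      then show ?thesis by (simp add: FL_star_eq_0[OF f])
    next
      case 2
      show ?thesis by (rule hausdorff_young_lt_2[OF f p(1) p2 q F refl 2])
    qed
  qed
qed

section \<open>Interpolation between the two endpoints\<close>

text \<open>Both endpoint constants are obtained before \<open>b\<close>, so \<open>C\<close> is
  uniform over the whole range of \<open>b\<close>. The bound is stated for finite sums and raised
  to the power \<open>b\<close>, ready for passage to the infinite sum.\<close>

lemma hausdorff_young_paley:
  assumes p: "1 < p" "p \<le> 2" and q: "q = p / (p - 1)"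
    and w: "\<And>\<xi>. w \<xi> > 0" and K: "K > 0" "\<And>\<xi>. U \<xi> \<le> K * w \<xi>"
  obtains C where "C > 0"
    "\<And>b f F \<phi> m. \<lbrakk>p \<le> b; b \<le> q; in_Lp M p f; finite F; \<And>\<xi>. \<phi> \<xi> > 0; m > 0;
       \<And>t. t > 0 \<Longrightarrow> t * (\<Sum>\<xi>\<in>{\<xi>\<in>F. t \<le> \<phi> \<xi>}. (w \<xi>)\<^sup>2) \<le> m\<rbrakk> \<Longrightarrow>
     (\<Sum>\<xi>\<in>F. (norm (FL_star M u f \<xi>) * \<phi> \<xi> powr (1 / b - 1 / q)) powr b
        * w \<xi> powr (1 - b / q) * U \<xi> powr (1 - b / p))
     \<le> (C * m powr (1 / b - 1 / q) * Lp_norm M p f) powr b"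
proof -
  obtain CP where CP: "CP > 0" "\<And>f F \<phi> m. \<lbrakk>in_Lp M p f; finite F; \<And>\<xi>. \<phi> \<xi> > 0; m > 0;
       \<And>t. t > 0 \<Longrightarrow> t * (\<Sum>\<xi>\<in>{\<xi>\<in>F. t \<le> \<phi> \<xi>}. (w \<xi>)\<^sup>2) \<le> m\<rbrakk> \<Longrightarrow>
     (\<Sum>\<xi>\<in>F. norm (FL_star M u f \<xi>) powr p * (\<phi> \<xi> * w \<xi>) powr (2 - p)) \<le>
       CP * m powr (2 - p) * (\<integral>x. norm (f x) powr p \<partial>M)"
    by (rule paley[OF p w K]) blast
  obtain CH where CH: "CH > 0" "\<And>f F. \<lbrakk>in_Lp M p f; finite F\<rbrakk> \<Longrightarrow>
     (\<Sum>\<xi>\<in>F. norm (FL_star M u f \<xi>) powr q * U \<xi> powr (2 - q)) \<le>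
       CH * (\<integral>x. norm (f x) powr p \<partial>M) powr (q - 1)"
    by (rule hausdorff_young[OF p q]) blast
  \<comment> \<open>The lower bound 1 later gives \<open>C \<le> C powr b\<close>.\<close>
  define C where "C = max 1 (max CP CH)"
  have C: "C \<ge> 1" "CP \<le> C" "CH \<le> C" by (auto simp: C_def)
  have q2: "q \<ge> 2" using p by (simp add: q field_simps)
  have pq: "p / q = p - 1" "q / p = q - 1" using p by (simp_all add: q field_simps)
  show ?thesis
  proof (rule that[of C])
    show "C > 0" using C by simp
    fix b m :: real and f :: "'a \<Rightarrow> complex" and F :: "'i set" and \<phi> :: "'i \<Rightarrow> real"
    assume b: "p \<le> b" "b \<le> q" and f: "in_Lp M p f" and F: "finite F"
      and \<phi>: "\<And>\<xi>. \<phi> \<xi> > 0" and m: "m > 0"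
      and weak: "\<And>t. t > 0 \<Longrightarrow> t * (\<Sum>\<xi>\<in>{\<xi>\<in>F. t \<le> \<phi> \<xi>}. (w \<xi>)\<^sup>2) \<le> m"
    define N where "N = (\<integral>x. norm (f x) powr p \<partial>M)"
    have b0: "b > 1" using b p by simp
    show "(\<Sum>\<xi>\<in>F. (norm (FL_star M u f \<xi>) * \<phi> \<xi> powr (1 / b - 1 / q)) powr b
        * w \<xi> powr (1 - b / q) * U \<xi> powr (1 - b / p))
     \<le> (C * m powr (1 / b - 1 / q) * Lp_norm M p f) powr b"
    proof (cases "N = 0")
      case True
      then show ?thesis using FL_star_eq_0[OF f] by (simp add: N_def)
    next
      case False
      moreover have "N \<ge> 0" by (simp add: N_def)
      ultimately have N: "N > 0" by simp
      obtain \<theta> where \<theta>: "0 \<le> \<theta>" "\<theta> \<le> 1" "b = (1 - \<theta>) * p + \<theta> * q"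
      proof (cases "p = q")
        \<comment> \<open>The endpoints coincide only at \<open>p = q = 2\<close>, where division by
          \<open>q - p\<close> is impossible and any \<open>\<theta>\<close> would do.\<close>
        case True
        then show ?thesis using b by (intro that[of 0]) auto
      next
        case False
        then have "p < q" using p q2 by simp
        define \<theta> where "\<theta> = (b - p) / (q - p)"
        have "\<theta> * (q - p) = b - p" using \<open>p < q\<close> by (simp add: \<theta>_def)
        then have "b = (1 - \<theta>) * p + \<theta> * q" by (simp add: algebra_simps)
        moreover have "0 \<le> \<theta>" "\<theta> \<le> 1" using \<open>p < q\<close> b by (simp_all add: \<theta>_def)
        ultimately show ?thesis by (intro that)
      qed
      have "b / q = (1 - \<theta>) * (p / q) + \<theta>" "b / p = (1 - \<theta>) + \<theta> * (q / p)"
        using p q2 by (simp_all add: \<theta>(3) add_divide_distrib)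
      \<comment> \<open>These are the exponents of \<open>w\<close>, \<open>U\<close> and
        \<open>N\<close> in the geometric mean of the endpoint bounds with weights
        \<open>1 - \<theta>\<close> and \<open>\<theta>\<close>. By \<open>E4\<close> below,
        \<open>\<phi>\<close> has the same exponent as \<open>w\<close>, so the two combine to
        \<open>\<phi> \<xi> * w \<xi>\<close>.\<close>
      then have E: "1 - b / q = (2 - p) * (1 - \<theta>)" "1 - b / p = (2 - q) * \<theta>" "b / p = (1 - \<theta>) + (q - 1) * \<theta>"
        unfolding pq by (simp_all add: algebra_simps)
      have E4: "(1 / b - 1 / q) * b = 1 - b / q" using b0 by (simp add: field_simps)
      define X where "X \<xi> = norm (FL_star M u f \<xi>) powr p * (\<phi> \<xi> * w \<xi>) powr (2 - p)" for \<xi>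
      define Y where "Y \<xi> = norm (FL_star M u f \<xi>) powr q * U \<xi> powr (2 - q)" for \<xi>
      define A where "A = C * m powr (2 - p) * N"
      define A' where "A' = C * N powr (q - 1)"
      \<comment> \<open>The geometric mean of the endpoint bounds. Since \<open>X\<close> and
        \<open>Y\<close> divided by \<open>A\<close> and \<open>A'\<close> have sums at most 1,
        Young's inequality applied termwise to the quotients sums to at most
        \<open>D\<close>.\<close>
      define D where "D = A powr (1 - \<theta>) * A' powr \<theta>"
      have A: "A > 0" "A' > 0" using C m N by (auto simp: A_def A'_def)
      have "(\<Sum>\<xi>\<in>F. X \<xi>) \<le> CP * m powr (2 - p) * N"
        unfolding X_def N_def by (rule CP(2)[OF f F \<phi> m weak])
      also have "\<dots> \<le> A" unfolding A_def using C N by (intro mult_right_mono) auto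
      finally have X: "(\<Sum>\<xi>\<in>F. X \<xi>) / A \<le> 1" using A by simp
      have "(\<Sum>\<xi>\<in>F. Y \<xi>) \<le> CH * N powr (q - 1)"
        unfolding Y_def N_def by (rule CH(2)[OF f F])
      also have "\<dots> \<le> A'" unfolding A'_def using C by (intro mult_right_mono) auto
      finally have Y: "(\<Sum>\<xi>\<in>F. Y \<xi>) / A' \<le> 1" using A by simp
      have pt: "(norm (FL_star M u f \<xi>) * \<phi> \<xi> powr (1 / b - 1 / q)) powr b
        * w \<xi> powr (1 - b / q) * U \<xi> powr (1 - b / p) \<le> D * ((1 - \<theta>) * (X \<xi> / A) + \<theta> * (Y \<xi> / A'))" for \<xi>
      proof (cases "FL_star M u f \<xi> = 0")
        case True
        then show ?thesis using b0 by (simp add: X_def Y_def)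
      next
        case False
        define a where "a = norm (FL_star M u f \<xi>)"
        have a: "a > 0" using False by (simp add: a_def)
        have XY: "X \<xi> > 0" "Y \<xi> > 0"
          using a \<phi>[of \<xi>] w[of \<xi>] U_pos[of \<xi>] by (auto simp: X_def Y_def a_def)
        have "(a * \<phi> \<xi> powr (1 / b - 1 / q)) powr b * w \<xi> powr (1 - b / q) * U \<xi> powr (1 - b / p)
          = a powr b * \<phi> \<xi> powr (1 - b / q) * w \<xi> powr (1 - b / q) * U \<xi> powr (1 - b / p)"
          using a by (simp only: powr_mult powr_ge_zero less_imp_le powr_powr E4)
        also have "\<dots> = a powr ((1 - \<theta>) * p + \<theta> * q) * (\<phi> \<xi> * w \<xi>) powr ((2 - p) * (1 - \<theta>)) * U \<xi> powr ((2 - q) * \<theta>)"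
          using \<phi>[of \<xi>] w[of \<xi>] unfolding E(1,2) \<theta>(3)[symmetric] by (simp add: powr_mult mult_ac)
        also have "\<dots> = X \<xi> powr (1 - \<theta>) * Y \<xi> powr \<theta>"
          using a \<phi>[of \<xi>] w[of \<xi>] U_pos[of \<xi>]
          by (simp add: X_def Y_def a_def[symmetric] powr_mult powr_powr powr_add mult_ac)
        also have "\<dots> = D * ((X \<xi> / A) powr (1 - \<theta>) * (Y \<xi> / A') powr \<theta>)"
          using A XY by (simp add: D_def powr_divide)
        also have "\<dots> \<le> D * ((1 - \<theta>) * (X \<xi> / A) + \<theta> * (Y \<xi> / A'))"
          using \<theta> A XY by (intro mult_left_mono Youngs_inequality_0) (auto simp: D_def)
        finally show ?thesis by (simp add: a_def)
      qed
      have "(\<Sum>\<xi>\<in>F. (norm (FL_star M u f \<xi>) * \<phi> \<xi> powr (1 / b - 1 / q)) powr b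
        * w \<xi> powr (1 - b / q) * U \<xi> powr (1 - b / p)) \<le>
        (\<Sum>\<xi>\<in>F. D * ((1 - \<theta>) * (X \<xi> / A) + \<theta> * (Y \<xi> / A')))"
        by (intro sum_mono pt)
      also have "\<dots> = D * ((1 - \<theta>) * ((\<Sum>\<xi>\<in>F. X \<xi>) / A) + \<theta> * ((\<Sum>\<xi>\<in>F. Y \<xi>) / A'))"
        by (simp only: sum_distrib_left[symmetric] sum.distrib sum_divide_distrib[symmetric])
      also have "\<dots> \<le> D * ((1 - \<theta>) * 1 + \<theta> * 1)"
        using \<theta> X Y A by (intro mult_left_mono add_mono) (auto simp: D_def)
      also have "\<dots> = C * m powr (1 - b / q) * N powr (b / p)"
        using C m N powr_add[of C "1 - \<theta>" \<theta>] unfolding D_def A_def A'_def E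
        by (simp add: powr_mult powr_powr powr_add mult_ac)
      \<comment> \<open>\<open>C \<ge> 1\<close> and \<open>b > 1\<close> allow \<open>C\<close> to
        go inside the power \<open>b\<close>.\<close>
      also have "\<dots> \<le> C powr b * m powr (1 - b / q) * N powr (b / p)"
        using C b0 powr_mono[of 1 b C] by (intro mult_right_mono) auto
      also have "\<dots> = (C * m powr (1 / b - 1 / q) * Lp_norm M p f) powr b"
        using C m N E4 by (simp add: Lp_norm_def N_def[symmetric] powr_mult powr_powr)
      finally show ?thesis .
    qed
  qed
qed

end

section \<open>From the Riesz basis to the infinite sum\<close>

text \<open>A finite partial sum is below the counting integral at level \<open>t\<close>, which is
  one member of the supremum. Finiteness of \<open>M_phi\<close> is what makes
  \<open>enn2real\<close> monotone here, since it sends infinity to 0.\<close>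

lemma M_phi_finite_sum_le:
  assumes "M_phi M v \<phi> < \<infinity>" "finite F" "t > 0"
  shows "t * (\<Sum>\<xi>\<in>{\<xi>\<in>F. t \<le> \<phi> \<xi>}. (Linf_norm M (v \<xi>))\<^sup>2) \<le> enn2real (M_phi M v \<phi>)"
proof -
  let ?w = "\<lambda>\<xi>. (Linf_norm M (v \<xi>))\<^sup>2" and ?F = "{\<xi>\<in>F. t \<le> \<phi> \<xi>}"
  have "ennreal (t * (\<Sum>\<xi>\<in>?F. ?w \<xi>)) = ennreal t * (\<Sum>\<xi>\<in>?F. ennreal (?w \<xi>))"
    using assms by (simp add: ennreal_mult sum_nonneg)
  also have "(\<Sum>\<xi>\<in>?F. ennreal (?w \<xi>)) = (\<integral>\<^sup>+\<xi>. ennreal (?w \<xi>) * indicator ?F \<xi> \<partial>count_space {\<xi>. t \<le> \<phi> \<xi>})"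
    using assms by (subst nn_integral_count_space'[where A = ?F]) auto
  also have "\<dots> \<le> (\<integral>\<^sup>+\<xi>. ennreal (?w \<xi>) \<partial>count_space {\<xi>. t \<le> \<phi> \<xi>})"
    by (intro nn_integral_mono) (auto simp: indicator_def)
  also have "ennreal t * \<dots> \<le> M_phi M v \<phi>"
    unfolding M_phi_def by (rule SUP_upper) (use assms in auto)
  finally have "ennreal (t * (\<Sum>\<xi>\<in>?F. ?w \<xi>)) \<le> M_phi M v \<phi>"
    by (simp add: mult_left_mono)
  then have "enn2real (ennreal (t * (\<Sum>\<xi>\<in>?F. ?w \<xi>))) \<le> enn2real (M_phi M v \<phi>)"
    using assms by (intro enn2real_mono) auto
  then show ?thesis using assms by (simp add: sum_nonneg)
qed

theorem mainTheorem8: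
  fixes M :: "'a measure"
    and u v :: "'i \<Rightarrow> 'a \<Rightarrow> complex"
    and L Lstar :: "('a \<Rightarrow> complex) \<Rightarrow> ('a \<Rightarrow> complex)"
    and lam :: "'i \<Rightarrow> complex"
    and p :: real
  assumes "sigma_finite_measure M"
    and "countable (UNIV :: 'i set)"
    and "\<And>\<xi>. L (u \<xi>) = (\<lambda>x. lam \<xi> * u \<xi> x)"
    and "\<And>\<xi>. Lstar (v \<xi>) = (\<lambda>x. cnj (lam \<xi>) * v \<xi> x)"
    and "\<And>\<xi>. in_Lp M 2 (u \<xi>) \<and> Lp_norm M 2 (u \<xi>) = 1"
    and "\<And>\<xi>. in_Lp M 2 (v \<xi>) \<and> Lp_norm M 2 (v \<xi>) = 1"
    and "\<And>\<xi> \<eta>. L2_inner M (u \<xi>) (v \<eta>) = (if \<xi> = \<eta> then 1 else 0)"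
    and "riesz_basis M u"
    and "\<And>\<xi>. in_Linf M (u \<xi>) \<and> in_Linf M (v \<xi>)"
    and "bdd_above (range (\<lambda>\<xi>. Linf_norm M (u \<xi>) / Linf_norm M (v \<xi>)))"
    and "1 < p" and "p \<le> 2"
  shows "\<exists>C>0. \<forall>b \<phi> f.
           p \<le> b \<longrightarrow> b \<le> p / (p - 1) \<longrightarrow>
           (\<forall>\<xi>. 0 < \<phi> \<xi>) \<longrightarrow> M_phi M v \<phi> < \<infinity> \<longrightarrow> in_Lp M p f \<longrightarrow>
           (let p' = p / (p - 1);
                g = (\<lambda>\<xi>. (norm (FL_star M u f \<xi>) * \<phi> \<xi> powr (1 / b - 1 / p')) powr b
                          * Linf_norm M (v \<xi>) powr (1 - b / p')
                          * Linf_norm M (u \<xi>) powr (1 - b / p))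
            in g summable_on UNIV \<and>
               (\<Sum>\<^sub>\<infinity>\<xi>. g \<xi>) powr (1 / b)
                 \<le> C * enn2real (M_phi M v \<phi>) powr (1 / b - 1 / p') * Lp_norm M p f)"
proof -
  obtain B where B: "B > 0" "\<And>F c. finite F \<Longrightarrow>
      (Lp_norm M 2 (\<lambda>x. \<Sum>\<xi>\<in>F. c \<xi> * u \<xi> x))\<^sup>2 \<le> B * (\<Sum>\<xi>\<in>F. (norm (c \<xi>))\<^sup>2)"
    using assms(8) unfolding riesz_basis_def by blast
  have u: "in_Lp M 2 (u \<xi>)" "Lp_norm M 2 (u \<xi>) = 1" "in_Linf M (u \<xi>)" for \<xi>
    using assms(5,9) by auto
  have v: "in_Lp M 2 (v \<xi>)" "Lp_norm M 2 (v \<xi>) = 1" "in_Linf M (v \<xi>)" for \<xi>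
    using assms(6,9) by auto
  note U = Linf_norm_normalized[OF u(3,1,2)] and V = Linf_norm_normalized(2)[OF v(3,1,2)]
  interpret sigma_finite_measure M by fact
  \<comment> \<open>Normalization makes the sup norms positive bounds, and duality turns the upper
    Riesz inequality into Bessel with the same constant.\<close>
  interpret bounded_bessel_system M u "\<lambda>\<xi>. Linf_norm M (u \<xi>)" B
    by unfold_locales (use u(1) U B(1) riesz_upper_imp_bessel[OF u(1) B] in auto)
  obtain K0 where K0: "Linf_norm M (u \<xi>) / Linf_norm M (v \<xi>) \<le> K0" for \<xi>
    using assms(10) by (auto simp: bdd_above_def)
  \<comment> \<open>The maximum guarantees \<open>K > 0\<close>.\<close>
  define K where "K = max K0 1"
  have K: "K > 0" "Linf_norm M (u \<xi>) \<le> K * Linf_norm M (v \<xi>)" for \<xi>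
  proof -
    show "K > 0" by (simp add: K_def)
    have "Linf_norm M (u \<xi>) / Linf_norm M (v \<xi>) \<le> K"
      using K0[of \<xi>] by (simp add: K_def)
    then show "Linf_norm M (u \<xi>) \<le> K * Linf_norm M (v \<xi>)"
      using V[of \<xi>] by (simp add: pos_divide_le_eq)
  qed
  define q where "q = p / (p - 1)"
  define g where "g b \<phi> f \<xi> = (norm (FL_star M u f \<xi>) * \<phi> \<xi> powr (1 / b - 1 / q)) powr b
      * Linf_norm M (v \<xi>) powr (1 - b / q) * Linf_norm M (u \<xi>) powr (1 - b / p)" for b \<phi> f \<xi>
  obtain C where C: "C > 0" "\<And>b f F \<phi> m. \<lbrakk>p \<le> b; b \<le> q; in_Lp M p f; finite F; \<And>\<xi>. \<phi> \<xi> > 0; m > 0;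
       \<And>t. t > 0 \<Longrightarrow> t * (\<Sum>\<xi>\<in>{\<xi>\<in>F. t \<le> \<phi> \<xi>}. (Linf_norm M (v \<xi>))\<^sup>2) \<le> m\<rbrakk> \<Longrightarrow>
     (\<Sum>\<xi>\<in>F. g b \<phi> f \<xi>) \<le> (C * m powr (1 / b - 1 / q) * Lp_norm M p f) powr b"
    unfolding g_def by (rule hausdorff_young_paley[OF assms(11,12) q_def V K]) blast
  have "g b \<phi> f summable_on UNIV \<and>
      (\<Sum>\<^sub>\<infinity>\<xi>. g b \<phi> f \<xi>) powr (1 / b) \<le> C * enn2real (M_phi M v \<phi>) powr (1 / b - 1 / q) * Lp_norm M p f"
    if b: "p \<le> b" "b \<le> q" and \<phi>: "\<forall>\<xi>. 0 < \<phi> \<xi>" and fin: "M_phi M v \<phi> < \<infinity>" and f: "in_Lp M p f"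
    for b \<phi> f
  proof -
    let ?m = "enn2real (M_phi M v \<phi>)"
    let ?Z = "C * ?m powr (1 / b - 1 / q) * Lp_norm M p f"
    obtain \<eta> :: 'i where True by simp \<comment> \<open>positivity of \<open>?m\<close> matters for \<open>b = q\<close>, since \<open>0 powr 0 = 0\<close>\<close>
    have "0 < \<phi> \<eta> * (Linf_norm M (v \<eta>))\<^sup>2" using \<phi> V[of \<eta>] by simp
    \<comment> \<open>Level \<open>t = \<phi> \<eta>\<close> tested on the single index
      \<open>\<eta>\<close>.\<close>
    also have "\<dots> \<le> ?m" using M_phi_finite_sum_le[OF fin, of "{\<eta>}" "\<phi> \<eta>"] \<phi>
      by (simp add: Collect_conv_if conj_commute cong: conj_cong)
    finally have m: "?m > 0" .
    \<comment> \<open>A bound independent of \<open>F\<close> on sums of nonnegative terms yields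
      both summability and the estimate of the infinite sum.\<close>
    have fin_sum: "(\<Sum>\<xi>\<in>F. g b \<phi> f \<xi>) \<le> ?Z powr b" if "finite F" for F
      by (rule C(2)[OF b f that _ m M_phi_finite_sum_le[OF fin that]]) (use \<phi> in auto)
    have nonneg: "g b \<phi> f \<xi> \<ge> 0" for \<xi> by (simp add: g_def)
    have sm: "g b \<phi> f summable_on UNIV"
      by (rule nonneg_bdd_above_summable_on) (use fin_sum nonneg in \<open>auto intro!: bdd_aboveI\<close>)
    have "(\<Sum>\<^sub>\<infinity>\<xi>. g b \<phi> f \<xi>) \<le> ?Z powr b"
      by (rule infsum_le_finite_sums[OF sm]) (rule fin_sum)
    then have "(\<Sum>\<^sub>\<infinity>\<xi>. g b \<phi> f \<xi>) powr (1 / b) \<le> (?Z powr b) powr (1 / b)"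
      using b assms(11) nonneg by (intro powr_mono2 infsum_nonneg) auto
    also have "\<dots> = ?Z"
      using b assms(11) C(1) by (simp add: powr_powr Lp_norm_def)
    finally show ?thesis using sm by simp
  qed
  then show ?thesis
    using C(1) unfolding Let_def q_def[symmetric] g_def[abs_def] by blast
qed

end
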